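(* Let $\Gamma$ be a finite connected graph and let $N\geq 1$. Then the pure braid group of $\Gamma$ on $N$ points, $\pi_1(\mathcal{C}^N(\Gamma))$ (with respect to any basepoint), is torsion-free.
   Context: A graph is regarded as a topological space (a one-dimensional complex, including all its vertices); it is not assumed to be simply connected. The configuration space of $N$ distinct labeled points on $\Gamma$ is $\mathcal{C}^N(\Gamma)=\{(x_1,\ldots,x_N)\in\Gamma^N : x_i\neq x_j \text{ for } i\neq j\}$, with the subspace topology from $\Gamma^N$. The pure braid group of $\Gamma$ (on $N$ points) is the fundamental group $\pi_1(\mathcal{C}^N(\Gamma))$. *)

theory Defs
  imports "HOL-Analysis.Analysis" "HOL-Algebra.Group"
begin

text \<open>
  A finite graph is a finite CW complex of dimension at most one: \<open>V\<close> is the set of vertices,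
  \<open>\<E>\<close> the set of open edges, and each open edge \<open>e\<close> has a characteristic map \<open>\<phi>\<close>, defined on the
  closed unit interval, that sends both endpoints to vertices.  Loops and multiple edges are
  allowed.  Since \<open>X\<close> is Hausdorff and there are only finitely many cells, each with compact
  closure, \<open>X\<close> automatically carries the weak topology and each open edge is open in \<open>X\<close>.
\<close>

definition finite_graph :: "'a topology \<Rightarrow> bool" where
  "finite_graph X \<longleftrightarrow>
     Hausdorff_space X \<and>
     (\<exists>V \<E>. finite V \<and> finite \<E> \<and> pairwise disjnt \<E> \<and> disjnt V (\<Union>\<E>) \<and>
        topspace X = V \<union> \<Union>\<E> \<and>
        (\<forall>e\<in>\<E>. \<exists>\<phi>. continuous_map (top_of_set {0..1::real}) X \<phi> \<and> \<phi> 0 \<in> V \<and> \<phi> 1 \<in> V \<and>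
           homeomorphic_map (top_of_set {0<..<1}) (subtopology X e) \<phi>))"

text \<open>
  An \<open>N\<close>-tuple of points is a function on \<open>{..<N}\<close>; following the library's product
  topology it has the value \<open>undefined\<close> at all other indices.
\<close>

definition config_space :: "nat \<Rightarrow> 'a topology \<Rightarrow> (nat \<Rightarrow> 'a) topology" where
  "config_space N X = subtopology (product_topology (\<lambda>_. X) {..<N}) {x. inj_on x {..<N}}"

definition loops_at :: "'a topology \<Rightarrow> 'a \<Rightarrow> (real \<Rightarrow> 'a) set" where
  "loops_at X p = {g. pathin X g \<and> g 0 = p \<and> g 1 = p}"

text \<open>
  Loops are total functions on \<open>real\<close>; their values outside the unit interval are irrelevant,
  as loops agreeing on \<open>{0..1}\<close> are homotopic.
\<close>

definition loop_homotopy :: "'a topology \<Rightarrow> 'a \<Rightarrow> ((real \<Rightarrow> 'a) \<times> (real \<Rightarrow> 'a)) set" where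
  "loop_homotopy X p =
     {(f, g). f \<in> loops_at X p \<and> g \<in> loops_at X p \<and>
        homotopic_with (\<lambda>h. h 0 = p \<and> h 1 = p) (top_of_set {0..1}) X f g}"

text \<open>
  The library's \<open>joinpaths\<close> requires a codomain of class \<^class>\<open>topological_space\<close>, so it does
  not apply to paths in an abstract topology.
\<close>

definition concat_loops :: "(real \<Rightarrow> 'a) \<Rightarrow> (real \<Rightarrow> 'a) \<Rightarrow> real \<Rightarrow> 'a" where
  "concat_loops f g = (\<lambda>t. if t \<le> 1/2 then f (2 * t) else g (2 * t - 1))"

definition fundamental_group :: "'a topology \<Rightarrow> 'a \<Rightarrow> (real \<Rightarrow> 'a) set monoid" where
  "fundamental_group X p =
     \<lparr>carrier = loops_at X p // loop_homotopy X p,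
      mult = (\<lambda>A B. \<Union>f\<in>A. \<Union>g\<in>B. loop_homotopy X p `` {concat_loops f g}),
      one = loop_homotopy X p `` {\<lambda>_. p}\<rparr>"

definition torsion_free :: "('a, 'b) monoid_scheme \<Rightarrow> bool" where
  "torsion_free G \<longleftrightarrow>
     (\<forall>x\<in>carrier G. \<forall>n::nat. n > 0 \<longrightarrow> x [^]\<^bsub>G\<^esub> n = \<one>\<^bsub>G\<^esub> \<longrightarrow> x = \<one>\<^bsub>G\<^esub>)"

lemma equiv_loop_homotopy: "equiv (loops_at X p) (loop_homotopy X p)"
proof (rule equivI)
  show "loop_homotopy X p \<subseteq> loops_at X p \<times> loops_at X p"
    by (auto simp: loop_homotopy_def)
  show "refl_on (loops_at X p) (loop_homotopy X p)"
    by (auto simp: refl_on_def loop_homotopy_def loops_at_def pathin_def)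
  show "sym (loop_homotopy X p)"
    by (auto simp: sym_def loop_homotopy_def homotopic_with_sym)
  show "trans (loop_homotopy X p)"
    by (auto simp: trans_def loop_homotopy_def intro: homotopic_with_trans)
qed

lemma concat_loops_in_loops_at:
  assumes "f \<in> loops_at X p" "g \<in> loops_at X p"
  shows "concat_loops f g \<in> loops_at X p"
proof -
  have f: "continuous_map (top_of_set {0..1}) X f" and g: "continuous_map (top_of_set {0..1}) X g"
    and e: "f 0 = p" "f 1 = p" "g 0 = p" "g 1 = p"
    using assms by (auto simp: loops_at_def pathin_def)
  have "continuous_map (top_of_set {0..1}) X (\<lambda>t. if t \<le> 1/2 then f (2 * t) else g (2 * t - 1))"
  proof (rule continuous_map_cases_le)
    show "continuous_map (subtopology (top_of_set {0..1}) {x \<in> topspace (top_of_set {0..1}). x \<le> 1/2}) X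
        (\<lambda>t::real. f (2 * t))"
      by (rule continuous_map_compose[OF _ f, unfolded o_def])
        (auto simp: subtopology_subtopology continuous_map_in_subtopology continuous_map_iff_continuous
          intro!: continuous_intros)
    show "continuous_map (subtopology (top_of_set {0..1}) {x \<in> topspace (top_of_set {0..1}). 1/2 \<le> x}) X
        (\<lambda>t::real. g (2 * t - 1))"
      by (rule continuous_map_compose[OF _ g, unfolded o_def])
        (auto simp: subtopology_subtopology continuous_map_in_subtopology continuous_map_iff_continuous
          intro!: continuous_intros)
  qed (auto simp: e mult.commute[of 2])
  then show ?thesis
    by (simp add: loops_at_def pathin_def concat_loops_def e)
qed

end

theory Submission
  imports Defs
begin

text \<open>
Why the group is torsion-free.  A configuration can be moved so that one particle at a time passes
between a vertex and the interior of an adjacent edge.  A move is recorded by the letter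
\<open>(i, A, B)\<close>: particle \<open>i\<close> passes between the vertex of \<open>A = {v}\<close> and the interior of the edge
\<open>B = {v, w}\<close>.  Every path of configurations is homotopic to a sequence of such moves, so it can be
described by a word of letters (\<open>realizes_exists\<close>).  Two kinds of relations between words suffice,
and each of them lifts from words to homotopies of paths:

  \<^item> consecutive moves of different particles at different vertices can be exchanged (\<open>square\<close>), and
  \<^item> two consecutive moves with the same letter undo each other (\<open>backtrack\<close>).

The words are thus governed by a right-angled Artin group, in which a letter commutes with the
letters of other particles at other vertices.  This is the embedding of a graph braid group into
such a group, in the spirit of Crisp and Wiest, with the strata of the configuration space in the role
of the vertices of a square complex.

Whether the shortest word of a loop is empty is detected by a Magnus representation.  A letter \<open>a\<close> acts as \<open>1 + D\<^sub>a\<close>, its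
inverse as \<open>1 - D\<^sub>a\<close>, where \<open>D\<^sub>a\<^sup>2 = 0\<close> and \<open>D\<^sub>a\<close> commutes with \<open>D\<^sub>b\<close> for exchangeable letters.
Acting on integer-valued functions on words, a product \<open>T\<close> of these operators is unipotent, so if
\<open>T\<^sup>n\<close> with \<open>n > 0\<close> fixes a function that vanishes on all long words, then so does \<open>T\<close>
(\<open>magnus_word_power_fixed\<close>).

These operators form a local system on the configuration space, so that transport along a path
depends only on its homotopy class (\<open>transport_homotopic\<close>) and can be computed from any word of the
path (\<open>transport_realizes\<close>).  Let \<open>w\<close> be a shortest word of a loop.  If \<open>w\<close> is empty, the loop is
null-homotopic.  Otherwise consider the indicator function \<open>f\<close> of the words that arise from \<open>w\<close> by
exchanges.  None of these words contains a letter twice in a row, because such a pair could be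
cancelled, contradicting the minimality of \<open>w\<close>; hence \<open>f\<close> belongs to the representation, and the
transport \<open>T\<close> along the loop satisfies \<open>T f [] = \<plusminus>1\<close> while \<open>f [] = 0\<close>.  So \<open>T\<close> moves \<open>f\<close>, hence so
does each power \<open>T\<^sup>n\<close> with \<open>n > 0\<close>, and no such power of the loop is null-homotopic.

All homotopies used are straight lines in barycentric coordinates.  To have these available, each
edge of the graph is cut into thirds, which turns the graph into a simplicial complex, without loops
or multiple edges, inside a real coordinate space (\<open>finite_graph_straightening\<close>).
\<close>

section \<open>Parallel transport in local systems\<close>

text \<open>
Transport data for a locally constant family of sets over \<open>X\<close>: all fibres are identified with
\<open>M\<close>, and \<open>c x y\<close> carries the fibre over \<open>y\<close> back to the fibre over \<open>x\<close> whenever \<open>y\<close> lies in a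
neighbourhood of \<open>x\<close>.  The relation \<open>near\<close> need not be symmetric: the neighbourhoods will be the open
stars of a stratification, and \<open>near x y\<close> then holds for \<open>x\<close> on the boundary of the stratum of \<open>y\<close>,
but not the other way round.
\<close>

locale local_system =
  fixes X :: "'x::topological_space set"
    and near :: "'x \<Rightarrow> 'x \<Rightarrow> bool"
    and c :: "'x \<Rightarrow> 'x \<Rightarrow> 'f \<Rightarrow> 'f"
    and M :: "'f set"
  assumes near_nbhd: "x \<in> X \<Longrightarrow> \<exists>U. open U \<and> x \<in> U \<and> (\<forall>y\<in>U \<inter> X. near x y)"
    and bij: "\<lbrakk>x \<in> X; y \<in> X; near x y\<rbrakk> \<Longrightarrow> bij_betw (c x y) M M"
    and refl: "\<lbrakk>x \<in> X; f \<in> M\<rbrakk> \<Longrightarrow> c x x f = f"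
    and cocycle: "\<lbrakk>x \<in> X; y \<in> X; z \<in> X; near x y; near y z; near x z; f \<in> M\<rbrakk>
      \<Longrightarrow> c x z f = c x y (c y z f)"
begin

text \<open>
A flat section of the pullback of the local system along \<open>H\<close>, over the set \<open>A\<close>.
\<close>

definition flat :: "('k::topological_space \<Rightarrow> 'x) \<Rightarrow> 'k set \<Rightarrow> ('k \<Rightarrow> 'f) \<Rightarrow> bool" where
  "flat H A F \<longleftrightarrow> F \<in> A \<rightarrow> M \<and>
     (\<forall>k\<in>A. \<exists>U. open U \<and> k \<in> U \<and> (\<forall>l\<in>U \<inter> A. F k = c (H k) (H l) (F l)))"

lemma flat_in: "flat H A F \<Longrightarrow> k \<in> A \<Longrightarrow> F k \<in> M"
  by (auto simp: flat_def)

lemma flat_nbhd: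
  assumes "flat H A F" "k \<in> A"
  obtains U where "open U" "k \<in> U" "\<forall>l\<in>U \<inter> A. F k = c (H k) (H l) (F l)"
proof -
  from assms have "\<exists>U. open U \<and> k \<in> U \<and> (\<forall>l\<in>U \<inter> A. F k = c (H k) (H l) (F l))"
    unfolding flat_def by (elim conjE bspec)
  then show ?thesis by (elim exE conjE) (rule that)
qed

lemma flatI:
  assumes "\<And>k. k \<in> A \<Longrightarrow> F k \<in> M"
    and "\<And>k. k \<in> A \<Longrightarrow> \<exists>U. open U \<and> k \<in> U \<and> (\<forall>l\<in>U \<inter> A. F k = c (H k) (H l) (F l))"
  shows "flat H A F"
  unfolding flat_def by (intro conjI ballI Pi_I assms)

lemma near_pullback:
  assumes "continuous_on A H" "H \<in> A \<rightarrow> X" "k \<in> A"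
  shows "\<exists>U. open U \<and> k \<in> U \<and> (\<forall>l\<in>U \<inter> A. near (H k) (H l))"
proof -
  have "H k \<in> X" using assms by auto
  from near_nbhd[OF this] obtain V where V: "open V" "H k \<in> V" "\<forall>y\<in>V \<inter> X. near (H k) y"
    by (elim exE conjE)
  then obtain U where "open U" "U \<inter> A = H -` V \<inter> A"
    using assms(1) by (metis continuous_on_open_invariant)
  moreover have "k \<in> U" "\<forall>l\<in>U \<inter> A. near (H k) (H l)"
    using \<open>U \<inter> A = H -` V \<inter> A\<close> V assms(2,3) by (auto simp: set_eq_iff)
  ultimately show ?thesis by blast
qed

text \<open>
Since each \<open>c x y\<close> is injective, agreement of two flat sections at a point is equivalent to their
agreement nearby; so the truth value of this agreement is locally constant.
\<close>

lemma flat_unique: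
  assumes A: "connected A" "continuous_on A H" "H \<in> A \<rightarrow> X"
    and F: "flat H A F" and G: "flat H A G"
    and k: "k \<in> A" "F k = G k" and l: "l \<in> A"
  shows "F l = G l"
proof -
  have "\<forall>a\<in>A. eventually (\<lambda>b. (F a = G a) = (F b = G b)) (at a within A)"
  proof
    fix a assume a: "a \<in> A"
    obtain U where U: "open U" "a \<in> U" "\<forall>l\<in>U \<inter> A. F a = c (H a) (H l) (F l)"
      using flat_nbhd[OF F a] .
    obtain V where V: "open V" "a \<in> V" "\<forall>l\<in>V \<inter> A. G a = c (H a) (H l) (G l)"
      using flat_nbhd[OF G a] .
    obtain W where W: "open W" "a \<in> W" "\<forall>l\<in>W \<inter> A. near (H a) (H l)"
      using near_pullback[OF A(2,3) a] by blast
    have "(F a = G a) = (F b = G b)" if "b \<in> U \<inter> V \<inter> W" "b \<in> A" for b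
    proof -
      have "inj_on (c (H a) (H b)) M"
        using bij[of "H a" "H b"] W that A(3) a by (auto simp: bij_betw_def)
      moreover have "F b \<in> M" "G b \<in> M"
        using F G that flat_in by auto
      moreover have "F a = c (H a) (H b) (F b)" "G a = c (H a) (H b) (G b)"
        by (rule bspec[OF U(3)] bspec[OF V(3)], use that in blast)+
      ultimately show ?thesis
        using inj_on_eq_iff by metis
    qed
    then show "eventually (\<lambda>b. (F a = G a) = (F b = G b)) (at a within A)"
      unfolding eventually_at_topological
      using U(1,2) V(1,2) W(1,2) by (intro exI[of _ "U \<inter> V \<inter> W"] conjI ballI impI) auto
  qed
  from connected_local_const[OF A(1) k(1) l this] k(2) show ?thesis by simp
qed

lemma flat_subset:
  assumes "flat H A F" "B \<subseteq> A"
  shows "flat H B F"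
proof (rule flatI)
  fix k assume k: "k \<in> B"
  with assms show "F k \<in> M" using flat_in by blast
  from k assms have "k \<in> A" by blast
  from flat_nbhd[OF assms(1) this] obtain U where
    U: "open U" "k \<in> U" "\<forall>l\<in>U \<inter> A. F k = c (H k) (H l) (F l)" .
  show "\<exists>U. open U \<and> k \<in> U \<and> (\<forall>l\<in>U \<inter> B. F k = c (H k) (H l) (F l))"
    using U(1,2) by (intro exI[of _ U] conjI ballI bspec[OF U(3)]) (use assms(2) in auto)
qed

lemma flat_cong:
  assumes "\<And>k. k \<in> A \<Longrightarrow> H k = H' k" "\<And>k. k \<in> A \<Longrightarrow> F k = F' k"
  shows "flat H A F \<longleftrightarrow> flat H' A F'"
  unfolding flat_def using assms by (intro conj_cong ball_cong ex_cong1 Pi_cong) auto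

lemma flat_compose:
  assumes F: "flat H A F" and u: "continuous_on B u" "u \<in> B \<rightarrow> A"
  shows "flat (H \<circ> u) B (F \<circ> u)"
proof (rule flatI)
  fix k assume k: "k \<in> B"
  then have uk: "u k \<in> A" using u(2) by auto
  with F show "(F \<circ> u) k \<in> M" using flat_in by auto
  obtain U where U: "open U" "u k \<in> U" "\<forall>l\<in>U \<inter> A. F (u k) = c (H (u k)) (H l) (F l)"
    using flat_nbhd[OF F uk] .
  obtain V where V: "open V" "V \<inter> B = u -` U \<inter> B"
    using u(1) U(1) by (metis continuous_on_open_invariant)
  have "(F \<circ> u) k = c ((H \<circ> u) k) ((H \<circ> u) l) ((F \<circ> u) l)" if "l \<in> V \<inter> B" for l
    unfolding o_def by (rule bspec[OF U(3)]) (use that V(2) u(2) in auto)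
  moreover have "k \<in> V" using k V(2) U(2) by auto
  ultimately show "\<exists>U. open U \<and> k \<in> U \<and> (\<forall>l\<in>U \<inter> B. (F \<circ> u) k = c ((H \<circ> u) k) ((H \<circ> u) l) ((F \<circ> u) l))"
    using V(1) by blast
qed

lemma flat_const:
  assumes "x \<in> X" "f \<in> M"
  shows "flat (\<lambda>_. x) A (\<lambda>_. f)"
  by (rule flatI) (use assms in \<open>auto simp: refl intro: exI[of _ UNIV]\<close>)

lemma flat_Un:
  assumes "closed A" "closed B" "flat H A F" "flat H B F"
  shows "flat H (A \<union> B) F"
proof (rule flatI)
  have *: "\<exists>U. open U \<and> k \<in> U \<and> (\<forall>l\<in>U \<inter> C. F k = c (H k) (H l) (F l))"
    if "closed C" "flat H C F" for k C
  proof (cases "k \<in> C")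
    case True
    with that(2) show ?thesis unfolding flat_def by (elim conjE bspec)
  next
    case False
    with that(1) show ?thesis by (intro exI[of _ "- C"]) auto
  qed
  fix k assume "k \<in> A \<union> B"
  with assms(3,4) show "F k \<in> M" using flat_in by blast
  obtain U V where UV: "open U" "k \<in> U" "\<forall>l\<in>U \<inter> A. F k = c (H k) (H l) (F l)"
    "open V" "k \<in> V" "\<forall>l\<in>V \<inter> B. F k = c (H k) (H l) (F l)"
    using *[OF assms(1,3), of k] *[OF assms(2,4), of k] by (elim exE conjE)
  have "\<forall>l\<in>(U \<inter> V) \<inter> (A \<union> B). F k = c (H k) (H l) (F l)"
    using UV(3,6) by blast
  moreover have "open (U \<inter> V)" "k \<in> U \<inter> V" using UV by auto
  ultimately show "\<exists>U. open U \<and> k \<in> U \<and> (\<forall>l\<in>U \<inter> (A \<union> B). F k = c (H k) (H l) (F l))"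
    by blast
qed

text \<open>
For connected \<open>A\<close>, this means that the pullback of the local system along \<open>H\<close> is trivial over \<open>A\<close>.
\<close>

definition extendable :: "('k::topological_space \<Rightarrow> 'x) \<Rightarrow> 'k set \<Rightarrow> bool" where
  "extendable H A \<longleftrightarrow> (\<forall>k\<in>A. \<forall>f\<in>M. \<exists>F. flat H A F \<and> F k = f)"

lemma extendable_subset: "extendable H A \<Longrightarrow> B \<subseteq> A \<Longrightarrow> extendable H B"
  unfolding extendable_def using flat_subset by (metis subsetD)

text \<open>
Near \<open>k0\<close>, a flat section is determined by its value at \<open>k0\<close>, with the inverse of \<open>c (H k0) (H k)\<close>
carrying it to \<open>k\<close>; the cocycle identity makes this section flat at the other points, too.
\<close>

lemma extendable_local:
  assumes "continuous_on A H" "H \<in> A \<rightarrow> X" "k0 \<in> A"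
  shows "\<exists>U. open U \<and> k0 \<in> U \<and> (\<forall>B \<subseteq> U \<inter> A. extendable H B)"
proof -
  obtain U where U: "open U" "k0 \<in> U" "\<forall>l\<in>U \<inter> A. near (H k0) (H l)"
    using near_pullback[OF assms] by blast
  have "extendable H B" if B: "B \<subseteq> U \<inter> A" for B
    unfolding extendable_def
  proof (intro ballI)
    fix k f assume k: "k \<in> B" and f: "f \<in> M"
    have HX: "H l \<in> X" if "l \<in> B" for l using that B assms(2) by auto
    have b: "bij_betw (c (H k0) (H l)) M M" if "l \<in> B" for l
      using bij[of "H k0" "H l"] HX[OF that] that B U(3) assms(2,3) by auto
    define f0 where "f0 = c (H k0) (H k) f"
    have f0: "f0 \<in> M" using b[OF k] f by (auto simp: f0_def bij_betw_def)
    define F where "F l = inv_into M (c (H k0) (H l)) f0" for l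
    have FM: "F l \<in> M" "c (H k0) (H l) (F l) = f0" if "l \<in> B" for l
      using b[OF that] f0 inv_into_into[of f0 "c (H k0) (H l)" M] f_inv_into_f[of f0 "c (H k0) (H l)" M]
      by (auto simp: F_def bij_betw_def)
    have "flat H B F"
    proof (rule flatI)
      fix l assume l: "l \<in> B"
      then show "F l \<in> M" using FM by auto
      obtain V where V: "open V" "l \<in> V" "\<forall>m\<in>V \<inter> A. near (H l) (H m)"
        using near_pullback[OF assms(1,2), of l] l B by (meson IntD2 subsetD)
      have "F l = c (H l) (H m) (F m)" if m: "m \<in> V \<inter> B" for m
      proof -
        have nr: "near (H l) (H m)" "near (H k0) (H l)" "near (H k0) (H m)"
          using V U m l B by auto
        have "c (H k0) (H l) (c (H l) (H m) (F m)) = c (H k0) (H m) (F m)"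
          using cocycle[of "H k0" "H l" "H m" "F m"] nr HX l m FM assms(2,3) by auto
        also have "\<dots> = c (H k0) (H l) (F l)" using FM l m by auto
        finally have "c (H k0) (H l) (c (H l) (H m) (F m)) = c (H k0) (H l) (F l)" .
        moreover have "c (H l) (H m) (F m) \<in> M"
          using bij[of "H l" "H m"] nr(1) HX l m FM(1)[of m] by (auto simp: bij_betw_def)
        ultimately show ?thesis
          using b[OF l] FM(1)[OF l] by (metis bij_betw_def inj_on_eq_iff)
      qed
      then show "\<exists>U. open U \<and> l \<in> U \<and> (\<forall>m\<in>U \<inter> B. F l = c (H l) (H m) (F m))"
        using V by blast
    qed
    moreover have "F k = f"
      using b[OF k] f by (simp add: F_def f0_def bij_betw_def)
    ultimately show "\<exists>F. flat H B F \<and> F k = f" by blast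
  qed
  with U show ?thesis by blast
qed

text \<open>
Sections over the two parts that agree at one point of the connected overlap agree on all of it.
\<close>

lemma extendable_Un:
  assumes cl: "closed A" "closed B" and con: "connected (A \<inter> B)" and m: "m \<in> A \<inter> B"
    and H: "continuous_on (A \<union> B) H" "H \<in> A \<union> B \<rightarrow> X"
    and ext: "extendable H A" "extendable H B"
  shows "extendable H (A \<union> B)"
proof -
  have *: "\<exists>F. flat H (A \<union> B) F \<and> F k = f"
    if "closed A" "closed B" "connected (A \<inter> B)" "m \<in> A \<inter> B" "continuous_on (A \<union> B) H"
      "H \<in> A \<union> B \<rightarrow> X" "extendable H A" "extendable H B" "k \<in> A" "f \<in> M" for A B k f
  proof -
    obtain F1 where F1: "flat H A F1" "F1 k = f"
      using \<open>extendable H A\<close> \<open>k \<in> A\<close> \<open>f \<in> M\<close> unfolding extendable_def by blast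
    have "F1 m \<in> M" using F1(1) that(4) flat_in by blast
    then obtain F2 where F2: "flat H B F2" "F2 m = F1 m"
      using \<open>extendable H B\<close> \<open>m \<in> A \<inter> B\<close> unfolding extendable_def by blast
    have eq: "F1 l = F2 l" if "l \<in> A \<inter> B" for l
    proof (rule flat_unique)
      show "connected (A \<inter> B)" "m \<in> A \<inter> B" "l \<in> A \<inter> B" by fact+
      show "continuous_on (A \<inter> B) H" "H \<in> A \<inter> B \<rightarrow> X"
        using \<open>continuous_on (A \<union> B) H\<close> \<open>H \<in> A \<union> B \<rightarrow> X\<close>
        by (auto intro: continuous_on_subset)
      show "flat H (A \<inter> B) F1" "flat H (A \<inter> B) F2"
        using F1 F2 flat_subset by blast+
    qed (use F2 in simp)
    define F where "F l = (if l \<in> A then F1 l else F2 l)" for l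
    have "flat H A F" using F1(1) flat_cong[of A H H F F1] by (simp add: F_def)
    moreover have "flat H B F" using F2(1) eq flat_cong[of B H H F F2] by (simp add: F_def)
    ultimately show ?thesis
      using that F1(2) by (intro exI[of _ F]) (auto intro!: flat_Un simp: F_def)
  qed
  show ?thesis
    unfolding extendable_def
  proof (intro ballI)
    fix k f assume "k \<in> A \<union> B" "f \<in> M"
    then show "\<exists>F. flat H (A \<union> B) F \<and> F k = f"
      using *[of A B k f] *[of B A k f] assms by (auto simp: Int_commute Un_commute)
  qed
qed

text \<open>
Bisection, applied to each of the two coordinates: small rectangles carry flat sections, and the
gluing lemma joins adjacent rectangles along their common side.
\<close>

lemma extendable_square:
  fixes H :: "real \<times> real \<Rightarrow> 'x"
  assumes H: "continuous_on ({0..1} \<times> {0..1}) H" "H \<in> {0..1} \<times> {0..1} \<rightarrow> X"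
  shows "extendable H ({0..1} \<times> {0..1})"
proof -
  have glue: "extendable H (C \<union> D)"
    if "extendable H C" "extendable H D" "C \<union> D \<subseteq> {0..1} \<times> {0..1}" "closed C" "closed D"
      "connected (C \<inter> D)" "C \<inter> D \<noteq> {}" for C D
  proof -
    from \<open>C \<inter> D \<noteq> {}\<close> obtain m where "m \<in> C \<inter> D" by blast
    then show ?thesis
      using that H by (intro extendable_Un[of C D m]) (auto intro: continuous_on_subset)
  qed
  have strip: "\<exists>e>0. extendable H (({t0 - e..t0 + e} \<inter> {0..1}) \<times> {0..1})" if t0: "t0 \<in> {0..1}" for t0
  proof -
    define P where "P a b \<longleftrightarrow> (0 \<le> a \<and> b \<le> 1 \<longrightarrow>
      (\<exists>e>0. extendable H (({t0 - e..t0 + e} \<inter> {0..1}) \<times> {a..b})))" for a b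
    have "(0::real) \<le> 1" by simp
    then have "P 0 1"
    proof (induction rule: Bolzano)
      case (trans a b c)
      show ?case unfolding P_def
      proof
        assume ac: "0 \<le> a \<and> c \<le> 1"
        with trans obtain e1 e2 where e: "e1 > 0" "e2 > 0"
          and x: "extendable H (({t0 - e1..t0 + e1} \<inter> {0..1}) \<times> {a..b})"
            "extendable H (({t0 - e2..t0 + e2} \<inter> {0..1}) \<times> {b..c})"
          by (auto simp: P_def)
        define e where "e = min e1 e2"
        define T where "T = {t0 - e..t0 + e} \<inter> {0..1}"
        have eT: "e > 0" "t0 \<in> T" using e t0 by (auto simp: e_def T_def)
        have eq: "T \<times> {a..b} \<inter> T \<times> {b..c} = T \<times> {b}" "T \<times> {a..b} \<union> T \<times> {b..c} = T \<times> {a..c}"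
          using trans by auto
        have "extendable H (T \<times> {a..b} \<union> T \<times> {b..c})"
        proof (rule glue)
          show "extendable H (T \<times> {a..b})"
            by (rule extendable_subset[OF x(1)]) (auto simp: T_def e_def)
          show "extendable H (T \<times> {b..c})"
            by (rule extendable_subset[OF x(2)]) (auto simp: T_def e_def)
          show "T \<times> {a..b} \<union> T \<times> {b..c} \<subseteq> {0..1} \<times> {0..1}"
            using ac trans by (auto simp: T_def)
          show "closed (T \<times> {a..b})" "closed (T \<times> {b..c})"
            by (auto simp: T_def intro!: closed_Times)
          show "connected (T \<times> {a..b} \<inter> T \<times> {b..c})"
            unfolding eq unfolding T_def Int_atLeastAtMost by (intro connected_Times) auto
          show "T \<times> {a..b} \<inter> T \<times> {b..c} \<noteq> {}"
            unfolding eq using eT(2) by blast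
        qed
        then have "extendable H (({t0 - e..t0 + e} \<inter> {0..1}) \<times> {a..c})"
          unfolding eq unfolding T_def .
        then show "\<exists>e>0. extendable H (({t0 - e..t0 + e} \<inter> {0..1}) \<times> {a..c})"
          using eT(1) by blast
      qed
    next
      case (local x)
      then have "(t0, x) \<in> {0..1} \<times> {0..1}" using t0 by auto
      from extendable_local[OF H this] obtain U where U: "open U" "(t0, x) \<in> U"
        "\<And>B. B \<subseteq> U \<inter> {0..1} \<times> {0..1} \<Longrightarrow> extendable H B" by blast
      obtain A B where AB: "open A" "open B" "(t0, x) \<in> A \<times> B" "A \<times> B \<subseteq> U"
        using open_prod_elim[OF U(1,2)] by blast
      obtain e where e: "e > 0" "cball t0 e \<subseteq> A" using AB open_contains_cball by blast
      obtain d where d: "d > 0" "ball x d \<subseteq> B" using AB open_contains_ball by blast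
      have "P a b" if ab: "a \<le> x \<and> x \<le> b \<and> b - a < d" for a b
        unfolding P_def
      proof
        assume 01: "0 \<le> a \<and> b \<le> 1"
        have "{t0 - e..t0 + e} \<subseteq> A" "{a..b} \<subseteq> B"
          using e d ab by (auto simp: subset_iff dist_real_def)
        then have "({t0 - e..t0 + e} \<inter> {0..1}) \<times> {a..b} \<subseteq> A \<times> B"
          by (intro Sigma_mono) auto
        moreover have "({t0 - e..t0 + e} \<inter> {0..1}) \<times> {a..b} \<subseteq> {0..1} \<times> {0..1}"
          using 01 by (intro Sigma_mono) auto
        ultimately have "({t0 - e..t0 + e} \<inter> {0..1}) \<times> {a..b} \<subseteq> U \<inter> {0..1} \<times> {0..1}"
          using AB(4) by blast
        then show "\<exists>e>0. extendable H (({t0 - e..t0 + e} \<inter> {0..1}) \<times> {a..b})"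
          using U(3) e by blast
      qed
      with d show ?case by blast
    qed
    then show ?thesis by (simp add: P_def)
  qed
  define Q where "Q a b \<longleftrightarrow> (0 \<le> a \<and> b \<le> 1 \<longrightarrow> extendable H ({a..b} \<times> {0..1}))" for a b
  have "(0::real) \<le> 1" by simp
  then have "Q 0 1"
  proof (induction rule: Bolzano)
    case (trans a b c)
    show ?case unfolding Q_def
    proof
      assume ac: "0 \<le> a \<and> c \<le> 1"
      have eq: "{a..b} \<times> {0..1::real} \<inter> {b..c} \<times> {0..1} = {b} \<times> {0..1}"
        "{a..b} \<times> {0..1::real} \<union> {b..c} \<times> {0..1} = {a..c} \<times> {0..1}"
        using trans by auto
      have "extendable H ({a..b} \<times> {0..1} \<union> {b..c} \<times> {0..1})"
      proof (rule glue)
        show "connected ({a..b} \<times> {0..1::real} \<inter> {b..c} \<times> {0..1})"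
          unfolding eq by (intro connected_Times) auto
        show "{a..b} \<times> {0..1::real} \<inter> {b..c} \<times> {0..1} \<noteq> {}"
          unfolding eq by auto
      qed (use trans ac in \<open>auto simp: Q_def intro!: closed_Times\<close>)
      then show "extendable H ({a..c} \<times> {0..1})" unfolding eq .
    qed
  next
    case (local x)
    then obtain e where e: "e > 0" "extendable H (({x - e..x + e} \<inter> {0..1}) \<times> {0..1})"
      using strip[of x] by auto
    have "Q a b" if "a \<le> x \<and> x \<le> b \<and> b - a < e" for a b
      unfolding Q_def using that by (auto intro!: extendable_subset[OF e(2)])
    with e show ?case by blast
  qed
  then show ?thesis by (simp add: Q_def)
qed

text \<open>
The direction is against the path: \<open>f0\<close> at the start is obtained from \<open>f1\<close> at the end.  With this
convention the operator of a concatenation is the composition of the operators in the same order.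
\<close>

definition transport :: "(real \<Rightarrow> 'x) \<Rightarrow> 'f \<Rightarrow> 'f \<Rightarrow> bool" where
  "transport g f0 f1 \<longleftrightarrow> (\<exists>F. flat g {0..1} F \<and> F 0 = f0 \<and> F 1 = f1)"

lemma transport_const_eq:
  assumes "x \<in> X" "flat (\<lambda>_. x) A F" "connected A" "k \<in> A" "l \<in> A"
  shows "F k = F l"
proof -
  have "F k \<in> M" using assms flat_in by blast
  then have "F l = (\<lambda>_. F k) l"
    using assms by (intro flat_unique[of A "\<lambda>_. x" F _ k l] flat_const) auto
  then show ?thesis by simp
qed

lemma transport_join:
  assumes g: "transport g f0 f1" and h: "transport h f1 f2" and gh: "pathfinish g = pathstart h"
  shows "transport (g +++ h) f0 f2"
proof -
  obtain F G where F: "flat g {0..1} F" "F 0 = f0" "F 1 = f1"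
    and G: "flat h {0..1} G" "G 0 = f1" "G 1 = f2"
    using g h by (auto simp: transport_def)
  let ?K = "\<lambda>t. if t \<le> 1/2 then F (2 * t) else G (2 * t - 1)"
  have mid: "g 1 = h 0" using gh by (simp add: pathfinish_def pathstart_def)
  have "flat (g \<circ> (\<lambda>t. 2 * t)) {0..1/2} (F \<circ> (\<lambda>t. 2 * t))"
    by (rule flat_compose[OF F(1)]) (auto intro!: continuous_intros)
  then have 1: "flat (g +++ h) {0..1/2} ?K"
    by (subst flat_cong[of _ "g +++ h" "g \<circ> (\<lambda>t. 2 * t)" ?K "F \<circ> (\<lambda>t. 2 * t)"])
      (auto simp: joinpaths_def)
  have "flat (h \<circ> (\<lambda>t. 2 * t - 1)) {1/2..1} (G \<circ> (\<lambda>t. 2 * t - 1))"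
    by (rule flat_compose[OF G(1)]) (auto intro!: continuous_intros)
  moreover have "(h \<circ> (\<lambda>t. 2 * t - 1)) t = (g +++ h) t \<and> (G \<circ> (\<lambda>t. 2 * t - 1)) t = ?K t"
    if "t \<in> {1/2..1}" for t
  proof (cases "t = 1/2")
    case True
    show ?thesis unfolding True using mid F(3) G(2) by (simp add: joinpaths_def)
  next
    case False
    with that show ?thesis by (simp add: joinpaths_def)
  qed
  ultimately have 2: "flat (g +++ h) {1/2..1} ?K"
    using flat_cong[of "{1/2..1}" "h \<circ> (\<lambda>t. 2 * t - 1)" "g +++ h" "G \<circ> (\<lambda>t. 2 * t - 1)" ?K] by blast
  have "flat (g +++ h) ({0..1/2} \<union> {1/2..1}) ?K"
    by (rule flat_Un[OF _ _ 1 2]) auto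
  moreover have "{0..1/2} \<union> {1/2..1} = {0..1::real}" by auto
  ultimately show ?thesis
    unfolding transport_def using F G by (intro exI[of _ ?K]) auto
qed

lemma transport_reverse:
  assumes "transport g f0 f1"
  shows "transport (reversepath g) f1 f0"
proof -
  obtain F where F: "flat g {0..1} F" "F 0 = f0" "F 1 = f1"
    using assms by (auto simp: transport_def)
  have "flat (g \<circ> (\<lambda>t. 1 - t)) {0..1} (F \<circ> (\<lambda>t. 1 - t))"
    by (rule flat_compose[OF F(1)]) (auto intro!: continuous_intros)
  then show ?thesis
    using F unfolding transport_def reversepath_def
    by (intro exI[of _ "F \<circ> (\<lambda>t. 1 - t)"]) (auto simp: o_def)
qed

text \<open>
A homotopy is a map on the square.  A flat section over the square restricts to sections over the two
paths, and it is constant on the two remaining sides, on which the homotopy does not move.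
\<close>

lemma transport_homotopic:
  assumes gh: "homotopic_paths X g h" and g: "transport g f0 f1"
  shows "transport h f0 f1"
proof -
  obtain F where F: "flat g {0..1} F" "F 0 = f0" "F 1 = f1"
    using g by (auto simp: transport_def)
  obtain H :: "real \<times> real \<Rightarrow> 'x" where H: "continuous_on ({0..1} \<times> {0..1}) H" "H \<in> {0..1} \<times> {0..1} \<rightarrow> X"
    "\<forall>s\<in>{0..1}. H (0, s) = g s" "\<forall>s\<in>{0..1}. H (1, s) = h s"
    "\<forall>t\<in>{0..1}. H (t, 0) = g 0 \<and> H (t, 1) = g 1"
    using gh unfolding homotopic_paths pathstart_def pathfinish_def o_def by blast
  have f1: "f1 \<in> M" using F flat_in[of g "{0..1}" F 1] by auto
  obtain G where G: "flat H ({0..1} \<times> {0..1}) G" "G (0, 1) = f1"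
    using extendable_square[OF H(1,2)] f1 unfolding extendable_def by force
  have path: "continuous_on {0..1} g" "g \<in> {0..1} \<rightarrow> X"
    using homotopic_paths_imp_path[OF gh] homotopic_paths_imp_subset[OF gh]
    by (auto simp: path_def path_image_def)
  have sl: "flat (\<lambda>s. H (t, s)) {0..1} (\<lambda>s. G (t, s))" if "t \<in> {0..1}" for t
  proof -
    have "continuous_on {0..1} (\<lambda>s. (t, s))"
      by (intro continuous_on_Pair continuous_on_const continuous_on_id)
    then show ?thesis
      using flat_compose[OF G(1), of "{0..1}" "\<lambda>s. (t, s)"] that by (auto simp: o_def)
  qed
  have sr: "flat (\<lambda>t. H (t, s)) {0..1} (\<lambda>t. G (t, s))" if "s \<in> {0..1}" for s
  proof -
    have "continuous_on {0..1} (\<lambda>t. (t, s))"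
      by (intro continuous_on_Pair continuous_on_const continuous_on_id)
    then show ?thesis
      using flat_compose[OF G(1), of "{0..1}" "\<lambda>t. (t, s)"] that by (auto simp: o_def)
  qed
  have "flat g {0..1} (\<lambda>s. G (0, s))"
    using sl[of 0] H(3) flat_cong[of "{0..1}" "\<lambda>s. H (0, s)" g] by auto
  then have "G (0, 0) = f0"
    using flat_unique[of "{0..1}" g "\<lambda>s. G (0, s)" F 1 0] path F G by auto
  moreover have "G (0, 0) = G (1, 0)"
  proof (rule transport_const_eq[of "g 0" "{0..1}" "\<lambda>t. G (t, 0)"])
    show "flat (\<lambda>_. g 0) {0..1} (\<lambda>t. G (t, 0))"
      using sr[of 0] H(5) flat_cong[of "{0..1}" "\<lambda>t. H (t, 0)" "\<lambda>_. g 0"] by auto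
  qed (use path in auto)
  moreover have "G (0, 1) = G (1, 1)"
  proof (rule transport_const_eq[of "g 1" "{0..1}" "\<lambda>t. G (t, 1)"])
    show "flat (\<lambda>_. g 1) {0..1} (\<lambda>t. G (t, 1))"
      using sr[of 1] H(5) flat_cong[of "{0..1}" "\<lambda>t. H (t, 1)" "\<lambda>_. g 1"] by auto
  qed (use path in auto)
  moreover have "flat h {0..1} (\<lambda>s. G (1, s))"
    using sl[of 1] H(4) flat_cong[of "{0..1}" "\<lambda>s. H (1, s)" h] by auto
  ultimately show ?thesis
    using G(2) unfolding transport_def by (intro exI[of _ "\<lambda>s. G (1, s)"]) auto
qed

end

section \<open>A Magnus representation for partially commuting letters\<close>

text \<open>
Functions on words serve as a dual of the ring of noncommutative power series modulo the relations
\<open>ab = ba\<close> for exchangeable letters and \<open>a\<^sup>2 = 0\<close>.  Working with functions avoids the quotient: the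
relations become conditions on the functions.
\<close>

definition magnus_functions :: "('l \<Rightarrow> 'l \<Rightarrow> bool) \<Rightarrow> ('l list \<Rightarrow> int) set" where
  "magnus_functions ind = {f. (\<forall>u a b v. ind a b \<longrightarrow> f (u @ [a, b] @ v) = f (u @ [b, a] @ v)) \<and>
     (\<forall>u a v. f (u @ [a, a] @ v) = 0)}"

text \<open>
For \<open>\<epsilon> = 1\<close> this is \<open>1 + D\<^sub>a\<close>, for \<open>\<epsilon> = -1\<close> its inverse \<open>1 - D\<^sub>a\<close>, where \<open>D\<^sub>a f u = f (u @ [a])\<close>.
\<close>

definition magnus :: "int \<Rightarrow> 'l \<Rightarrow> ('l list \<Rightarrow> int) \<Rightarrow> 'l list \<Rightarrow> int" where
  "magnus \<epsilon> a f = (\<lambda>u. f u + \<epsilon> * f (u @ [a]))"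

lemma magnus_in:
  assumes "f \<in> magnus_functions ind"
  shows "magnus \<epsilon> a f \<in> magnus_functions ind"
proof -
  have 1: "f (u @ [b, c] @ v) = f (u @ [c, b] @ v)" if "ind b c" for u b c v
    using assms that by (auto simp: magnus_functions_def)
  have 2: "f (u @ [b, b] @ v) = 0" for u b v
    using assms by (auto simp: magnus_functions_def)
  show ?thesis
    unfolding magnus_functions_def
  proof (intro CollectI conjI allI impI)
    fix u b c v assume "ind b c"
    then show "magnus \<epsilon> a f (u @ [b, c] @ v) = magnus \<epsilon> a f (u @ [c, b] @ v)"
      using 1[of b c u v] 1[of b c u "v @ [a]"] by (simp add: magnus_def)
  next
    fix u b v
    show "magnus \<epsilon> a f (u @ [b, b] @ v) = 0"
      using 2[of u b v] 2[of u b "v @ [a]"] by (simp add: magnus_def)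
  qed
qed

lemma magnus_inverse:
  assumes "f \<in> magnus_functions ind"
  shows "magnus \<epsilon> a (magnus (- \<epsilon>) a f) = f"
proof -
  have "f (u @ [a, a]) = 0" for u
    using assms by (force simp: magnus_functions_def dest: spec[of _ "[]"])
  then show ?thesis
    by (auto simp: magnus_def algebra_simps fun_eq_iff)
qed

lemma magnus_commute:
  assumes "f \<in> magnus_functions ind" "ind a b"
  shows "magnus \<epsilon> a (magnus \<delta> b f) = magnus \<delta> b (magnus \<epsilon> a f)"
proof -
  have "f (u @ [a, b] @ []) = f (u @ [b, a] @ [])" for u
    using assms unfolding magnus_functions_def by blast
  then show ?thesis
    by (auto simp: magnus_def algebra_simps fun_eq_iff)
qed

lemma magnus_bij: "bij_betw (magnus \<epsilon> a) (magnus_functions ind) (magnus_functions ind)"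
proof (rule bij_betw_byWitness[where f' = "magnus (- \<epsilon>) a"])
  show "\<forall>f\<in>magnus_functions ind. magnus (- \<epsilon>) a (magnus \<epsilon> a f) = f"
    using magnus_inverse[of _ ind "- \<epsilon>" a] by auto
qed (use magnus_inverse magnus_in in auto)

primrec magnus_word :: "(int \<times> 'l) list \<Rightarrow> ('l list \<Rightarrow> int) \<Rightarrow> 'l list \<Rightarrow> int" where
  "magnus_word [] f = f"
| "magnus_word (l # w) f = magnus (fst l) (snd l) (magnus_word w f)"

lemma magnus_word_in:
  "f \<in> magnus_functions ind \<Longrightarrow> magnus_word w f \<in> magnus_functions ind"
  by (induction w) (auto intro: magnus_in)

lemma magnus_word_diff: "magnus_word w (\<lambda>u. f u - g u) = (\<lambda>u. magnus_word w f u - magnus_word w g u)"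
proof (induction w)
  case (Cons l w)
  show ?case by (simp only: magnus_word.simps Cons.IH) (auto simp: magnus_def algebra_simps)
qed simp

text \<open>
Expanding the product of the factors \<open>1 + \<epsilon>D\<^sub>a\<close>, each choice of a subword of \<open>w\<close> contributes one term;
only the full word is long enough to reach the words of length \<open>n\<close>.
\<close>

lemma magnus_word_top_coefficient:
  assumes "\<And>v. length v \<noteq> n \<Longrightarrow> f v = 0" "length u + length w \<le> n"
  shows "magnus_word w f u =
    (if length u + length w = n then prod_list (map fst w) * f (u @ map snd w) else 0)"
  using assms(2)
proof (induction w arbitrary: u)
  case Nil
  then show ?case using assms(1) by auto
next
  case (Cons l w)
  then show ?case by (auto simp: magnus_def)
qed

lemma magnus_word_unipotent:
  assumes "\<And>v. length v > length u \<Longrightarrow> f v = 0"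
  shows "magnus_word w f u = f u"
proof -
  have "magnus_word w f v = f v" if "length v \<ge> length u" for v
    using that
  proof (induction w arbitrary: v)
    case (Cons l w)
    then show ?case using assms by (auto simp: magnus_def)
  qed simp
  then show ?thesis by simp
qed

text \<open>
Write \<open>T = 1 + U\<close>, so that \<open>U\<close> shortens the support by one.  By induction \<open>U f\<close> is fixed by \<open>T\<close>, so
\<open>T\<^sup>n f = f + n U f\<close>, which forces \<open>n U f = 0\<close>.
\<close>

lemma magnus_word_power_fixed:
  assumes n: "n > 0" and fixed: "(magnus_word w ^^ n) f = f" and d: "\<And>v. length v \<ge> d \<Longrightarrow> f v = 0"
  shows "magnus_word w f = f"
  using fixed d
proof (induction d arbitrary: f)
  case 0
  then have "f = (\<lambda>_. 0)" by auto
  then show ?case using magnus_word_diff[of w f f] by auto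
next
  case (Suc d)
  let ?T = "magnus_word w"
  define g where "g = (\<lambda>u. ?T f u - f u)"
  have diff: "(?T ^^ k) (\<lambda>u. h u - h' u) = (\<lambda>u. (?T ^^ k) h u - (?T ^^ k) h' u)" for k h h'
    by (induction k) (auto simp: magnus_word_diff)
  have "(?T ^^ n) g = g"
    unfolding g_def diff Suc.prems(1)
    using funpow_swap1[of ?T n f] Suc.prems(1) by metis
  moreover have "g v = 0" if "length v \<ge> d" for v
    using magnus_word_unipotent[of v f w] Suc.prems(2) that by (auto simp: g_def)
  ultimately have Tg: "?T g = g" by (rule Suc.IH)
  have "(?T ^^ k) f = (\<lambda>u. f u + int k * g u)" for k
  proof (induction k)
    case (Suc k)
    have "?T (\<lambda>u. f u + int k * g u) = (\<lambda>u. ?T f u + int k * ?T g u)"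
    proof -
      have add: "?T (\<lambda>u. h u + int k * h' u) v = ?T h v + int k * ?T h' v" for h h' v
        by (induction w arbitrary: v) (auto simp: magnus_def algebra_simps)
      show ?thesis by (rule ext) (rule add)
    qed
    then have "(?T ^^ Suc k) f = (\<lambda>u. ?T f u + int k * g u)"
      by (simp only: funpow.simps o_apply Suc Tg)
    moreover have "?T f = (\<lambda>u. f u + g u)" by (simp add: g_def)
    ultimately show ?case by (simp add: algebra_simps)
  qed simp
  then have "int n * g u = 0" for u
    using Suc.prems(1) by (metis add_cancel_right_right)
  then show ?case using n by (auto simp: g_def fun_eq_iff)
qed

section \<open>Configurations on a straight-line graph\<close>

definition supp :: "('v \<Rightarrow> real) \<Rightarrow> 'v set" where
  "supp p = {v. p v \<noteq> 0}"

lemma outside_supp: "supp p \<subseteq> A \<Longrightarrow> u \<notin> A \<Longrightarrow> p u = 0"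
  by (auto simp: supp_def)

definition common_edge :: "('v \<Rightarrow> real) \<Rightarrow> ('v \<Rightarrow> real) \<Rightarrow> bool" where
  "common_edge p q \<longleftrightarrow> (\<exists>v w. supp p \<union> supp q \<subseteq> {v, w})"

definition seg :: "(nat \<Rightarrow> 'v \<Rightarrow> real) \<Rightarrow> (nat \<Rightarrow> 'v \<Rightarrow> real) \<Rightarrow> real \<Rightarrow> nat \<Rightarrow> 'v \<Rightarrow> real" where
  "seg x y t = (\<lambda>i v. (1 - t) * x i v + t * y i v)"

lemma seg_0 [simp]: "seg x y 0 = x" and seg_1 [simp]: "seg x y 1 = y"
  and seg_same [simp]: "seg x x = (\<lambda>_. x)"
  by (auto simp: seg_def algebra_simps fun_eq_iff)

lemma seg_flip: "seg x y t = seg y x (1 - t)"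
  by (simp add: seg_def algebra_simps)

lemma reversepath_seg [simp]: "reversepath (seg x y) = seg y x"
  by (auto simp: reversepath_def seg_flip[of x y])

lemma pathstart_seg [simp]: "pathstart (seg x y) = x" and pathfinish_seg [simp]: "pathfinish (seg x y) = y"
  by (auto simp: pathstart_def pathfinish_def)

lemma continuous_seg:
  assumes "continuous_on S a" "continuous_on S g"
  shows "continuous_on S (\<lambda>k. seg z (g k) (a k))"
proof -
  have "continuous_on S (\<lambda>k. g k i v)" for i v
    by (rule continuous_on_product_then_coordinatewise[OF
          continuous_on_product_then_coordinatewise[OF assms(2)]])
  then show ?thesis
    unfolding seg_def
    by (intro continuous_on_coordinatewise_then_product) (intro continuous_intros assms)
qed

lemma path_seg [simp]: "path (seg x y)"
  unfolding path_def by (intro continuous_seg[of _ "\<lambda>t. t" "\<lambda>_. y", simplified])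

text \<open>
A letter \<open>(i, A, B)\<close> records that particle \<open>i\<close> passes between the vertex in \<open>A\<close> and the interior of
the edge with endpoints \<open>B\<close>.  The direction is not part of the letter, since the position of the
particle determines it.
\<close>

type_synonym 'v letter = "nat \<times> 'v set \<times> 'v set"

text \<open>
Moves of one particle can only be made in the given order, and moves at one vertex exclude each other
because a vertex has room for one particle.
\<close>

definition independent :: "'v letter \<Rightarrow> 'v letter \<Rightarrow> bool" where
  "independent a b \<longleftrightarrow> fst a \<noteq> fst b \<and> fst (snd a) \<noteq> fst (snd b)"

lemma independent_sym: "independent a b \<Longrightarrow> independent b a"
  by (auto simp: independent_def)

primrec loop_power :: "(real \<Rightarrow> 'c::topological_space) \<Rightarrow> nat \<Rightarrow> real \<Rightarrow> 'c" where
  "loop_power g 0 = (\<lambda>_. g 0)"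
| "loop_power g (Suc n) = loop_power g n +++ g"

text \<open>
The points of a simplicial graph in barycentric coordinates: \<open>supp p\<close> is the vertex or the pair of
endpoints of the edge that contains \<open>p\<close> in its interior.  The set of edges is not made explicit; the
last assumption says that a closed edge is in \<open>P\<close> as far as it is spanned by points of \<open>P\<close>.
\<close>

locale straight_graph =
  fixes P :: "('v \<Rightarrow> real) set" and N :: nat
  assumes nonneg: "p \<in> P \<Longrightarrow> 0 \<le> p v"
    and edge: "p \<in> P \<Longrightarrow> \<exists>v w. supp p \<subseteq> {v, w}"
    and total: "p \<in> P \<Longrightarrow> sum p (supp p) = 1"
    and face_convex: "\<lbrakk>p \<in> P; q \<in> P; supp p \<subseteq> supp q; 0 \<le> t; t \<le> 1\<rbrakk>
      \<Longrightarrow> (\<lambda>v. (1 - t) * p v + t * q v) \<in> P"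
begin

lemma supp_nonempty: "p \<in> P \<Longrightarrow> supp p \<noteq> {}"
  using total by force

lemma finite_supp: "p \<in> P \<Longrightarrow> finite (supp p)"
  using edge by (meson finite.emptyI finite.insertI finite_subset)

lemma sum_edge:
  assumes "p \<in> P" "supp p \<subseteq> {v, w}" "v \<noteq> w"
  shows "p v + p w = 1"
proof -
  have "sum p (supp p) = sum p {v, w}"
    using assms by (intro sum.mono_neutral_left) (auto simp: supp_def)
  then show ?thesis using total[OF assms(1)] assms(3) by simp
qed

lemma vertex_value:
  assumes "p \<in> P" "supp p = {v}"
  shows "p v = 1" "u \<noteq> v \<Longrightarrow> p u = 0"
  using total[OF assms(1)] assms(2) by (auto simp: supp_def)

lemma edge_eq:
  assumes "p \<in> P" "q \<in> P" "supp p \<union> supp q \<subseteq> {v, w}" "p v = q v"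
  shows "p = q"
proof (rule ext)
  fix u
  have "p w = q w" if "v \<noteq> w"
    using sum_edge[of p v w] sum_edge[of q v w] that assms by auto
  moreover have "p u = 0 \<and> q u = 0" if "u \<notin> {v, w}"
    using that assms(3) by (auto simp: supp_def)
  ultimately show "p u = q u"
    using assms(4) by (cases "u \<in> {v, w}"; cases "v = w") auto
qed

lemma edge_less:
  assumes "p \<in> P" "q \<in> P" "supp p \<union> supp q \<subseteq> {v, w}" "p \<noteq> q" "u \<in> {v, w}"
  shows "p u \<noteq> q u"
  using edge_eq[of p q v w] edge_eq[of p q w v] assms by (auto simp: insert_commute)

lemma common_edge_less:
  assumes "p \<in> P" "q \<in> P" "common_edge p q" "p \<noteq> q"
  shows "\<exists>u. p u < q u"
proof -
  obtain v w where vw: "supp p \<union> supp q \<subseteq> {v, w}" using assms by (auto simp: common_edge_def)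
  have "p v \<noteq> q v" using edge_less[OF assms(1,2) vw assms(4)] by auto
  moreover have "v \<noteq> w"
  proof
    assume "v = w"
    then have "supp p = {v}" "supp q = {v}" using vw supp_nonempty assms by blast+
    then show False using vertex_value(1)[of p v] vertex_value(1)[of q v] assms \<open>p v \<noteq> q v\<close> by simp
  qed
  ultimately show ?thesis
    using sum_edge[of p v w] sum_edge[of q v w] assms vw by (cases "p v < q v") (auto, smt (verit))
qed

text \<open>
The weights are nonnegative with sum one, so weight one at \<open>v\<close> would leave nothing for the other
vertices.
\<close>

lemma less_one:
  assumes "p \<in> P" "supp p = {v}" "q \<in> P" "q \<noteq> p"
  shows "q v < 1"
proof (rule ccontr)
  assume *: "\<not> q v < 1"
  then have v: "v \<in> supp q" by (auto simp: supp_def)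
  have "sum q (supp q) = q v + sum q (supp q - {v})"
    using v finite_supp[OF assms(3)] by (simp add: sum.remove)
  moreover have "sum q (supp q - {v}) \<ge> 0" using nonneg[OF assms(3)] by (intro sum_nonneg) auto
  ultimately have "q v = 1" "sum q (supp q - {v}) = 0" using * total[OF assms(3)] by linarith+
  then have "supp q - {v} = {}"
    using sum_nonneg_eq_0_iff[of "supp q - {v}" q] finite_supp[OF assms(3)] nonneg[OF assms(3)]
    by (auto simp: supp_def)
  with v have "supp q = {v}" by blast
  then have "q = p"
    using edge_eq[of q p v v] vertex_value(1)[of p v] vertex_value(1)[of q v] assms by simp
  with assms show False by simp
qed

text \<open>
All other points of a closed edge lie on the same side of an endpoint, so comparing with an endpoint
gives the same answer for all of them.
\<close>

lemma vertex_extreme: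
  assumes p: "p \<in> P" "supp p = {v}" and q: "q \<in> P" "supp q \<subseteq> {v, w}" "q \<noteq> p"
  shows "(p u < q u \<longleftrightarrow> u = w) \<and> (q u < p u \<longleftrightarrow> u = v)"
proof -
  have qv: "q v < 1" using less_one[OF p q(1,3)] .
  have vw: "v \<noteq> w"
  proof
    assume "v = w"
    then have "supp q = {v}" using q supp_nonempty by auto
    then show False using vertex_value(1)[of q v] q qv by simp
  qed
  then have "q w > 0" using sum_edge[of q v w] q qv by simp
  then show ?thesis
    using vertex_value[OF p] qv vw outside_supp[OF q(2), of u] by (cases "u = v"; cases "u = w") auto
qed

definition Conf :: "(nat \<Rightarrow> 'v \<Rightarrow> real) set" where
  "Conf = {x. (\<forall>i<N. x i \<in> P) \<and> inj_on x {..<N}}"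

lemma Conf_point: "x \<in> Conf \<Longrightarrow> i < N \<Longrightarrow> x i \<in> P"
  by (auto simp: Conf_def)

lemma Conf_neq: "x \<in> Conf \<Longrightarrow> i < N \<Longrightarrow> j < N \<Longrightarrow> i \<noteq> j \<Longrightarrow> x i \<noteq> x j"
  by (auto simp: Conf_def inj_on_def)

lemma ConfI: "(\<And>i. i < N \<Longrightarrow> x i \<in> P) \<Longrightarrow> (\<And>i j. i < N \<Longrightarrow> j < N \<Longrightarrow> i \<noteq> j \<Longrightarrow> x i \<noteq> x j) \<Longrightarrow> x \<in> Conf"
  by (auto simp: Conf_def inj_on_def)

lemma Conf_vertex_neq:
  assumes "x \<in> Conf" "i < N" "j < N" "supp (x i) = {v}" "supp (x j) = {v}"
  shows "i = j"
proof (rule ccontr)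
  assume "i \<noteq> j"
  then have "x i \<noteq> x j" using Conf_neq assms by blast
  moreover have "x i = x j"
    using edge_eq[of "x i" "x j" v v] vertex_value(1)[of "x i" v] vertex_value(1)[of "x j" v] Conf_point assms
    by simp
  ultimately show False by simp
qed

text \<open>
\<open>below x y\<close> says that \<open>x\<close> lies in the closure of the stratum of \<open>y\<close>: each particle of \<open>y\<close> stays in
the interior of its edge or moves to an end of it, and particles on a common edge keep their order.
The coordinate \<open>u\<close> at one end of an edge serves to express the order on the edge; at vertices off the
edge both comparisons are false.
\<close>

definition below :: "(nat \<Rightarrow> 'v \<Rightarrow> real) \<Rightarrow> (nat \<Rightarrow> 'v \<Rightarrow> real) \<Rightarrow> bool" where
  "below x y \<longleftrightarrow> (\<forall>i<N. supp (x i) \<subseteq> supp (y i)) \<and>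
     (\<forall>i<N. \<forall>j<N. common_edge (y i) (y j) \<longrightarrow> (\<forall>u. x i u < x j u \<longleftrightarrow> y i u < y j u))"

lemma below_supp: "below x y \<Longrightarrow> i < N \<Longrightarrow> supp (x i) \<subseteq> supp (y i)"
  by (auto simp: below_def)

lemma below_order: "\<lbrakk>below x y; i < N; j < N; common_edge (y i) (y j)\<rbrakk> \<Longrightarrow> x i u < x j u \<longleftrightarrow> y i u < y j u"
  by (auto simp: below_def)

lemma below_refl [simp]: "below x x"
  by (auto simp: below_def)

lemma common_edge_mono: "common_edge p q \<Longrightarrow> supp p' \<subseteq> supp p \<Longrightarrow> supp q' \<subseteq> supp q \<Longrightarrow> common_edge p' q'"
  unfolding common_edge_def by (meson Un_mono order_trans)

lemma common_edge_same_supp: "p \<in> P \<Longrightarrow> supp p = supp q \<Longrightarrow> common_edge p q"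
  using edge[of p] by (auto simp: common_edge_def)

lemma below_trans: "below x y \<Longrightarrow> below y z \<Longrightarrow> below x z"
  unfolding below_def using common_edge_mono by (meson order_trans)

text \<open>
Both orders on a common edge are inherited from the configuration \<open>x\<close> below.
\<close>

lemma below_sandwich:
  assumes "below x y" "below x z" "\<And>i. i < N \<Longrightarrow> supp (y i) \<subseteq> supp (z i)"
  shows "below y z"
  unfolding below_def
proof (intro conjI allI impI)
  fix i j u assume ij: "i < N" "j < N" "common_edge (z i) (z j)"
  then have "common_edge (y i) (y j)" using common_edge_mono assms(3) by blast
  then show "y i u < y j u \<longleftrightarrow> z i u < z j u"
    using below_order[OF assms(1), of i j u] below_order[OF assms(2), of i j u] ij by simp
qed (use assms in auto)

text \<open>
The open star of \<open>x\<close> is a neighbourhood: positive coordinates stay positive and strict inequalities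
between coordinates stay strict; and two particles of \<open>x\<close> on a common edge do have different
coordinates at both ends of it.
\<close>

lemma below_nbhd:
  assumes x: "x \<in> Conf"
  shows "\<exists>U. open U \<and> x \<in> U \<and> (\<forall>y\<in>U. (\<forall>i<N. y i \<in> P) \<longrightarrow> y \<in> Conf \<and> below x y)"
proof -
  have cc: "continuous_on UNIV (\<lambda>y. y i v)" for i :: nat and v :: 'v
    by (rule continuous_on_product_then_coordinatewise) simp
  have op: "open {y :: nat \<Rightarrow> 'v \<Rightarrow> real. y i v < y j v}" "open {y :: nat \<Rightarrow> 'v \<Rightarrow> real. 0 < y i v}"
    for i j v
    using cc by (auto intro!: open_Collect_less continuous_on_const)
  define U :: "(nat \<Rightarrow> 'v \<Rightarrow> real) set" where "U = (\<Inter>i<N. \<Inter>v\<in>supp (x i). {y. 0 < y i v}) \<inter>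
    (\<Inter>i<N. \<Inter>j<N. \<Inter>v\<in>{v \<in> supp (x i) \<union> supp (x j). x i v < x j v}. {y. y i v < y j v})"
  have "open U"
    unfolding U_def using finite_supp Conf_point[OF x]
    by (intro open_Int open_INT op ballI) auto
  moreover have "x \<in> U"
    using nonneg Conf_point[OF x] by (auto simp: U_def supp_def less_le)
  moreover have "y \<in> Conf \<and> below x y" if y: "y \<in> U" "\<forall>i<N. y i \<in> P" for y
  proof
    have s: "supp (x i) \<subseteq> supp (y i)" if "i < N" for i
      using y(1) that by (force simp: U_def supp_def)
    have o: "y i v < y j v" if "i < N" "j < N" "x i v < x j v" for i j v
    proof -
      have "v \<in> supp (x i) \<union> supp (x j)" using that(3) by (auto simp: supp_def)
      then show ?thesis using y(1) that by (auto simp: U_def)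
    qed
    show "y \<in> Conf"
    proof (rule ConfI)
      fix i j assume ij: "i < N" "j < N" "i \<noteq> j"
      then have "x i \<noteq> x j" using Conf_neq[OF x] by blast
      then obtain v where "x i v < x j v \<or> x j v < x i v" by (meson ext linorder_less_linear)
      then show "y i \<noteq> y j" using o[of i j v] o[of j i v] ij by auto
    qed (use y in auto)
    show "below x y"
      unfolding below_def
    proof (intro conjI allI impI s)
      fix i j u assume ij: "i < N" "j < N" "common_edge (y i) (y j)"
      then obtain v w where vw: "supp (y i) \<union> supp (y j) \<subseteq> {v, w}" by (auto simp: common_edge_def)
      then have vw': "supp (x i) \<union> supp (x j) \<subseteq> {v, w}" using s ij by blast
      show "x i u < x j u \<longleftrightarrow> y i u < y j u"
      proof (cases "i = j \<or> u \<notin> {v, w}")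
        case True
        then show ?thesis
          using vw vw' outside_supp[of "x i" "{v, w}" u] outside_supp[of "x j" "{v, w}" u]
            outside_supp[of "y i" "{v, w}" u] outside_supp[of "y j" "{v, w}" u] by auto
      next
        case False
        then have "x i u \<noteq> x j u"
          using edge_less[OF Conf_point[OF x ij(1)] Conf_point[OF x ij(2)] vw'] Conf_neq[OF x ij(1,2)] by auto
        then show ?thesis using o[of i j u] o[of j i u] ij by fastforce
      qed
    qed
  qed
  ultimately show ?thesis by blast
qed

lemma
  assumes x: "x \<in> Conf" and y: "y \<in> Conf" and below: "below x y" and t: "0 \<le> t" "t \<le> 1"
  shows seg_in_Conf: "seg x y t \<in> Conf" and seg_upper: "below x (seg x y t)"
    and seg_supp: "0 < t \<Longrightarrow> i < N \<Longrightarrow> supp (seg x y t i) = supp (y i)"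
proof -
  let ?m = "seg x y t"
  have s: "supp (?m i) = supp (y i)" if "0 < t" "i < N" for i
  proof -
    have "(1 - t) * x i v + t * y i v = 0 \<longleftrightarrow> y i v = 0" for v
    proof -
      have "0 \<le> (1 - t) * x i v" "0 \<le> t * y i v"
        using nonneg[OF Conf_point[OF x that(2)], of v] nonneg[OF Conf_point[OF y that(2)], of v] t by auto
      moreover have "y i v = 0 \<Longrightarrow> x i v = 0"
        using below_supp[OF below that(2)] by (auto simp: supp_def)
      ultimately show ?thesis using that(1) by (auto simp: add_nonneg_eq_0_iff)
    qed
    then show ?thesis by (auto simp: supp_def seg_def)
  qed
  then show "0 < t \<Longrightarrow> i < N \<Longrightarrow> supp (seg x y t i) = supp (y i)" .
  have o: "x i u < x j u \<longleftrightarrow> ?m i u < ?m j u" if "i < N" "j < N" "common_edge (y i) (y j)" for i j u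
  proof (cases "t = 0")
    case False
    then have t0: "t > 0" using t by simp
    have eq: "x i u < x j u \<longleftrightarrow> y i u < y j u" using below_order[OF below that] .
    show ?thesis
    proof (cases "x i u < x j u")
      case True
      then have "t * y i u < t * y j u" "(1 - t) * x i u \<le> (1 - t) * x j u"
        using eq t t0 by (auto intro: mult_left_mono)
      then show ?thesis using True by (simp add: seg_def)
    next
      case False
      then have "t * y j u \<le> t * y i u" "(1 - t) * x j u \<le> (1 - t) * x i u"
        using eq t by (auto intro!: mult_left_mono)
      then show ?thesis using False by (simp add: seg_def)
    qed
  qed simp
  show "?m \<in> Conf"
  proof (cases "t = 0")
    case False
    then have t0: "t > 0" using t by simp
    show ?thesis
    proof (rule ConfI)
      fix i assume "i < N"
      then show "?m i \<in> P"
        unfolding seg_def using face_convex Conf_point x y below_supp[OF below] t by blast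
    next
      fix i j assume ij: "i < N" "j < N" "i \<noteq> j"
      show "?m i \<noteq> ?m j"
      proof
        assume eq: "?m i = ?m j"
        then have j: "common_edge (y i) (y j)"
          using s[OF t0 ij(1)] s[OF t0 ij(2)] common_edge_same_supp[OF Conf_point[OF y ij(1)]] by auto
        obtain u where "y i u < y j u"
          using common_edge_less[OF Conf_point[OF y ij(1)] Conf_point[OF y ij(2)] j Conf_neq[OF y ij]] by blast
        then have "?m i u < ?m j u" using o[OF ij(1,2) j, of u] below_order[OF below ij(1,2) j, of u] by simp
        with eq show False by simp
      qed
    qed
  qed (use x in simp)
  show "below x ?m"
  proof (cases "t = 0")
    case False
    then have t0: "t > 0" using t by simp
    show ?thesis
      unfolding below_def
    proof (intro conjI allI impI)
      fix i j u assume ij: "i < N" "j < N" "common_edge (?m i) (?m j)"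
      then have "common_edge (y i) (y j)"
        using common_edge_mono[OF ij(3)] s[OF t0 ij(1)] s[OF t0 ij(2)] by blast
      then show "x i u < x j u \<longleftrightarrow> ?m i u < ?m j u" using o ij by blast
    qed (use below_supp[OF below] s[OF t0] in auto)
  qed simp
qed

definition star :: "(nat \<Rightarrow> 'v \<Rightarrow> real) \<Rightarrow> (nat \<Rightarrow> 'v \<Rightarrow> real) set" where
  "star z = {y \<in> Conf. below z y}"

lemma seg_in_star:
  assumes "x \<in> star z" "y \<in> star z" "below x y \<or> below y x"
  shows "path_image (seg x y) \<subseteq> star z"
proof -
  have *: "seg x y t \<in> star z" if "x \<in> star z" "y \<in> star z" "below x y" "t \<in> {0..1}" for x y t
    using that seg_in_Conf[of x y t] seg_upper[of x y t] below_trans[of z x] by (auto simp: star_def)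
  show ?thesis
    using assms *[of x y] *[of y x "1 - _"] seg_flip[of x y] by (auto simp: path_image_def)
qed

text \<open>
The star of \<open>z\<close> is starlike with respect to \<open>z\<close>.  The cone of a path \<open>g\<close> from \<open>z\<close> is a map on the
square, and its restriction to the other three sides depends only on the endpoints of \<open>g\<close>.
\<close>

lemma star_homotopic:
  assumes z: "z \<in> Conf" and g: "path g" "path_image g \<subseteq> star z" and h: "path h" "path_image h \<subseteq> star z"
    and eq: "pathstart g = pathstart h" "pathfinish g = pathfinish h"
  shows "homotopic_paths Conf g h"
proof -
  \<comment> \<open>the three sides of the square other than the one that carries the given path\<close>
  define q :: "real \<Rightarrow> real \<times> real" where
    "q = linepath (1, 0) (0, 0) +++ linepath (0, 0) (0, 1) +++ linepath (0, 1) (1, 1)"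
  define H where "H g k = seg z (g (snd k)) (fst k)"
    for g :: "real \<Rightarrow> nat \<Rightarrow> 'v \<Rightarrow> real" and k :: "real \<times> real"
  have *: "homotopic_paths Conf g (H g \<circ> q)" if g: "path g" "path_image g \<subseteq> star z" for g
  proof -
    have sq: "homotopic_paths ({0..1} \<times> {0..1}) (linepath (1, 0) (1, 1)) q"
    proof (rule homotopic_paths_linear)
      fix t :: real assume t: "t \<in> {0..1}"
      have cv: "convex ({0..1::real} \<times> {0..1::real})" by (intro convex_Times) auto
      have "path_image q \<subseteq> {0..1} \<times> {0..1}"
        unfolding q_def
        by (intro subset_path_image_join; simp only: path_image_linepath)
          (intro closed_segment_subset cv; simp)+
      then have "q t \<in> {0..1} \<times> {0..1}" using t by (auto simp: path_image_def)
      moreover have "linepath (1, 0) (1, 1) t \<in> {0..1::real} \<times> {0..1::real}"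
        using t by (auto simp: linepath_def)
      ultimately show "closed_segment (linepath (1, 0) (1, 1) t) (q t) \<subseteq> {0..1} \<times> {0..1}"
        using cv by (intro closed_segment_subset)
    qed (auto simp: q_def)
    have "continuous_on ({0..1} \<times> {0..1}) (H g)"
      unfolding H_def
    proof (rule continuous_seg)
      show "continuous_on ({0..1} \<times> {0..1}) (\<lambda>k::real \<times> real. g (snd k))"
        using g(1) unfolding path_def
        by (rule continuous_on_compose2) (auto intro!: continuous_intros)
    qed (intro continuous_intros)
    moreover have "H g \<in> {0..1} \<times> {0..1} \<rightarrow> Conf"
    proof
      fix k :: "real \<times> real" assume "k \<in> {0..1} \<times> {0..1}"
      then have "g (snd k) \<in> star z" "0 \<le> fst k" "fst k \<le> 1"
        using g(2) by (auto simp: path_image_def)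
      then show "H g k \<in> Conf" unfolding H_def using seg_in_Conf[OF z] by (auto simp: star_def)
    qed
    ultimately have "homotopic_paths Conf (H g \<circ> linepath (1, 0) (1, 1)) (H g \<circ> q)"
      using homotopic_paths_continuous_image[OF sq] by blast
    moreover have "H g \<circ> linepath (1, 0) (1, 1) = g"
      by (auto simp: H_def linepath_def fun_eq_iff)
    ultimately show ?thesis by simp
  qed
  have "H g \<circ> q = H h \<circ> q"
  proof
    fix t
    have "g 0 = h 0" "g 1 = h 1" using eq by (auto simp: pathstart_def pathfinish_def)
    then show "(H g \<circ> q) t = (H h \<circ> q) t"
      by (simp add: H_def q_def linepath_def joinpaths_def seg_def)
  qed
  then show ?thesis
    using *[OF g] *[OF h] homotopic_paths_sym homotopic_paths_trans by metis
qed

section \<open>Elementary moves of a configuration\<close>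


text \<open>
Only the particle of the letter changes its face.  All particles may also move within their faces, as
long as the order on the edges is kept.
\<close>

definition up :: "(nat \<Rightarrow> 'v \<Rightarrow> real) \<Rightarrow> 'v letter \<Rightarrow> (nat \<Rightarrow> 'v \<Rightarrow> real) \<Rightarrow> bool" where
  "up x a y \<longleftrightarrow> x \<in> Conf \<and> y \<in> Conf \<and> below x y \<and> fst a < N \<and>
     supp (x (fst a)) = fst (snd a) \<and> supp (y (fst a)) = snd (snd a) \<and> fst (snd a) \<noteq> snd (snd a) \<and>
     (\<forall>k<N. k \<noteq> fst a \<longrightarrow> supp (x k) = supp (y k))"

definition step :: "(nat \<Rightarrow> 'v \<Rightarrow> real) \<Rightarrow> 'v letter \<Rightarrow> (nat \<Rightarrow> 'v \<Rightarrow> real) \<Rightarrow> bool" where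
  "step x a y \<longleftrightarrow> up x a y \<or> up y a x"

definition same_stratum :: "(nat \<Rightarrow> 'v \<Rightarrow> real) \<Rightarrow> (nat \<Rightarrow> 'v \<Rightarrow> real) \<Rightarrow> bool" where
  "same_stratum x y \<longleftrightarrow> x \<in> Conf \<and> y \<in> Conf \<and> below x y \<and> below y x"

lemma same_stratum_sym: "same_stratum x y \<Longrightarrow> same_stratum y x"
  by (auto simp: same_stratum_def)

lemma same_stratum_trans: "same_stratum x y \<Longrightarrow> same_stratum y z \<Longrightarrow> same_stratum x z"
  using below_trans by (auto simp: same_stratum_def)

lemma same_stratum_supp: "same_stratum x y \<Longrightarrow> i < N \<Longrightarrow> supp (x i) = supp (y i)"
  using below_supp[of x y i] below_supp[of y x i] by (auto simp: same_stratum_def)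

lemma step_sym: "step x a y \<longleftrightarrow> step y a x"
  by (auto simp: step_def)

lemma step_Conf: "step x a y \<Longrightarrow> x \<in> Conf \<and> y \<in> Conf"
  by (auto simp: step_def up_def)

lemma step_below: "step x a y \<Longrightarrow> below x y \<or> below y x"
  by (auto simp: step_def up_def)

lemma up_same_stratum:
  assumes a: "up x a y" and x: "same_stratum x x'" and y: "same_stratum y y'"
  shows "up x' a y'"
proof -
  have xs: "supp (x' i) = supp (x i)" and ys: "supp (y' i) = supp (y i)" if "i < N" for i
    using same_stratum_supp[OF x that] same_stratum_supp[OF y that] by simp_all
  have "below x' x" "below x y" "below y y'" using assms by (simp_all add: up_def same_stratum_def)
  then have "below x' y'" using below_trans by metis
  moreover have "x' \<in> Conf" "y' \<in> Conf" using x y by (simp_all add: same_stratum_def)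
  ultimately show ?thesis
    using a unfolding up_def by (simp add: xs ys)
qed

lemma step_same_stratum: "step x a y \<Longrightarrow> same_stratum x x' \<Longrightarrow> same_stratum y y' \<Longrightarrow> step x' a y'"
  unfolding step_def using up_same_stratum by blast

lemma proper_face:
  assumes "p \<in> P" "q \<in> P" "supp p \<subset> supp q"
  shows "\<exists>v w. v \<noteq> w \<and> supp p = {v} \<and> supp q = {v, w}"
proof -
  obtain v w where vw: "supp q \<subseteq> {v, w}" using edge assms by blast
  obtain a where a: "a \<in> supp p" using supp_nonempty assms by blast
  obtain b where b: "b \<in> supp q" "b \<notin> supp p" using assms(3) by blast
  have "a \<in> supp q" "a \<noteq> b" using a b assms(3) by auto
  then have "{v, w} = {a, b}" using vw b(1) by auto
  then have "supp q = {a, b}" using vw b(1) \<open>a \<in> supp q\<close> by auto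
  moreover from this have "supp p = {a}" using assms(3) a b(2) by auto
  ultimately show ?thesis using \<open>a \<noteq> b\<close> by blast
qed

lemma common_edge_at_vertex:
  assumes "common_edge p q" "v \<in> supp p"
  shows "\<exists>w. supp p \<union> supp q \<subseteq> {v, w}"
proof -
  obtain a b where ab: "supp p \<union> supp q \<subseteq> {a, b}" using assms by (auto simp: common_edge_def)
  then have "{a, b} = {v, a} \<or> {a, b} = {v, b}" using assms(2) by auto
  then show ?thesis using ab by metis
qed

lemma up_vertex:
  assumes "up x a y"
  shows "\<exists>v w. v \<noteq> w \<and> fst (snd a) = {v} \<and> snd (snd a) = {v, w}"
proof -
  let ?i = "fst a"
  have "supp (x ?i) \<subset> supp (y ?i)" "x ?i \<in> P" "y ?i \<in> P"
    using assms below_supp[of x y ?i] Conf_point unfolding up_def by auto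
  then show ?thesis using proper_face assms unfolding up_def by metis
qed

text \<open>
A particle that is the first one on its edge, seen from the unoccupied vertex \<open>v\<close>, can be moved to
\<open>v\<close>.
\<close>

lemma nearest_to_vertex:
  assumes x: "x \<in> Conf" and j: "j < N" and p: "p \<in> P" "supp p = {v}" and v: "v \<in> supp (x j)"
    and free: "\<And>l. l < N \<Longrightarrow> l \<noteq> j \<Longrightarrow> x l \<noteq> p"
    and first: "\<And>l w. l < N \<Longrightarrow> l \<noteq> j \<Longrightarrow> supp (x j) \<union> supp (x l) \<subseteq> {v, w} \<Longrightarrow> x l v < x j v"
  shows "x(j := p) \<in> Conf" "below (x(j := p)) x"
proof -
  show "x(j := p) \<in> Conf"
    by (rule ConfI) (use p free Conf_point[OF x] Conf_neq[OF x] in auto)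
  have *: "(p u < x l u \<longleftrightarrow> x j u < x l u) \<and> (x l u < p u \<longleftrightarrow> x l u < x j u)"
    if l: "l < N" "l \<noteq> j" and J: "common_edge (x j) (x l)" for l u
  proof -
    obtain w where w: "supp (x j) \<union> supp (x l) \<subseteq> {v, w}"
      using common_edge_at_vertex[OF J, of v] v by auto
    have lt: "x l v < x j v" using first[OF l w] .
    have wl: "supp (x l) \<subseteq> {v, w}" using w by auto
    have ex: "(p u < x l u \<longleftrightarrow> u = w) \<and> (x l u < p u \<longleftrightarrow> u = v)"
      using vertex_extreme[OF p Conf_point[OF x l(1)] wl free[OF l]] .
    have "v \<noteq> w"
      using vertex_extreme[OF p Conf_point[OF x l(1)] wl free[OF l], of v] by auto
    then have "x l w > x j w"
      using sum_edge[of "x l" v w] sum_edge[of "x j" v w] Conf_point[OF x] l j w lt by auto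
    then show ?thesis
      using ex lt \<open>v \<noteq> w\<close> outside_supp[of "x l" "{v, w}" u] outside_supp[of "x j" "{v, w}" u] w
      by (cases "u = v"; cases "u = w") auto
  qed
  show "below (x(j := p)) x"
    unfolding below_def
  proof (intro conjI allI impI)
    fix k l u assume "k < N" "l < N" "common_edge (x k) (x l)"
    then show "(x(j := p)) k u < (x(j := p)) l u \<longleftrightarrow> x k u < x l u"
      using *[of l u] *[of k u] by (auto simp: common_edge_def Un_commute)
  qed (use p v in auto)
qed

text \<open>
In \<open>z\<close> the particle \<open>i\<close> has left the vertex \<open>v\<close> of \<open>x\<close>, and no other particle can have come between
it and \<open>v\<close>.
\<close>

lemma below_vertex_first:
  assumes xz: "x \<in> Conf" "z \<in> Conf" "below x z" and i: "i < N" "supp (x i) = {v}"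
    and l: "l < N" "l \<noteq> i" and w: "supp (z i) \<union> supp (z l) \<subseteq> {v, w}"
  shows "z l v < z i v"
proof -
  have "common_edge (z l) (z i)" using w by (auto simp: common_edge_def)
  moreover have "x l v < x i v"
    using less_one[OF Conf_point[OF xz(1) i(1)] i(2) Conf_point[OF xz(1) l(1)] Conf_neq[OF xz(1) l(1) i(1) l(2)]]
      vertex_value(1)[OF Conf_point[OF xz(1) i(1)] i(2)] by simp
  ultimately show ?thesis using below_order[OF xz(3) l(1) i(1), of v] by simp
qed

lemma below_vertex_free:
  assumes xz: "x \<in> Conf" "z \<in> Conf" "below x z" and i: "i < N" "supp (x i) = {v}"
    and l: "l < N" "l \<noteq> i"
  shows "z l \<noteq> x i"
proof
  assume "z l = x i"
  then have "supp (x l) = {v}"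
    using below_supp[OF xz(3) l(1)] supp_nonempty[OF Conf_point[OF xz(1) l(1)]] i by auto
  then show False using Conf_vertex_neq[OF xz(1) i(1) l(1)] i l by auto
qed

text \<open>
A particle that has left its vertex can be returned to it alone, while all others stay where they are.
This splits the passage from \<open>x\<close> to \<open>z\<close> into elementary moves.
\<close>

lemma retract_particle:
  assumes xz: "x \<in> Conf" "z \<in> Conf" "below x z" and i: "i < N" "supp (x i) = {v}"
  shows "z(i := x i) \<in> Conf" "below (z(i := x i)) z" "below x (z(i := x i))"
proof -
  have v: "v \<in> supp (z i)" using below_supp[OF xz(3) i(1)] i by auto
  note near = nearest_to_vertex[OF xz(2) i(1) Conf_point[OF xz(1) i(1)] i(2) v
      below_vertex_free[OF xz i] below_vertex_first[OF xz i]]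
  show "z(i := x i) \<in> Conf" "below (z(i := x i)) z" using near by auto
  have *: "(x i u < x l u \<longleftrightarrow> x i u < z l u) \<and> (x l u < x i u \<longleftrightarrow> z l u < x i u)"
    if l: "l < N" "l \<noteq> i" and J: "common_edge (x i) (z l)" for l u
  proof -
    obtain w where w: "supp (x i) \<union> supp (z l) \<subseteq> {v, w}"
      using common_edge_at_vertex[OF J, of v] i by auto
    then have sub: "supp (x l) \<subseteq> {v, w}" "supp (z l) \<subseteq> {v, w}" using below_supp[OF xz(3) l(1)] by auto
    note p = Conf_point[OF xz(1) i(1)] i(2)
    show ?thesis
      using vertex_extreme[OF p Conf_point[OF xz(1) l(1)] sub(1) Conf_neq[OF xz(1) l(1) i(1) l(2)], of u]
        vertex_extreme[OF p Conf_point[OF xz(2) l(1)] sub(2) below_vertex_free[OF xz i l], of u] by simp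
  qed
  show "below x (z(i := x i))"
    unfolding below_def
  proof (intro conjI allI impI)
    fix k l u assume kl: "k < N" "l < N" "common_edge ((z(i := x i)) k) ((z(i := x i)) l)"
    then show "x k u < x l u \<longleftrightarrow> (z(i := x i)) k u < (z(i := x i)) l u"
      using *[of l u] *[of k u] below_order[OF xz(3) kl(1,2), of u]
      by (cases "k = i"; cases "l = i") (auto simp: common_edge_def Un_commute)
  qed (use below_supp[OF xz(3)] i in auto)
qed

lemma square_up_up:
  assumes a: "up x a y" and b: "up y b z" and ab: "independent a b"
  shows "\<exists>y'. up x b y' \<and> up y' a z"
proof -
  obtain i A B where ai: "a = (i, A, B)" by (cases a) auto
  obtain j C D where bj: "b = (j, C, D)" by (cases b) auto
  have ij: "i < N" "j < N" "i \<noteq> j" using a b ab by (auto simp: up_def independent_def ai bj)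
  obtain v where v: "supp (x i) = {v}" using up_vertex[OF a] a unfolding up_def ai by auto
  have xz: "x \<in> Conf" "z \<in> Conf" "below x z" using a b below_trans unfolding up_def by blast+
  note r = retract_particle[OF xz ij(1) v]
  have "up x b (z(i := x i))" "up (z(i := x i)) a z"
    using a b r ij xz unfolding up_def ai bj by auto
  then show ?thesis by blast
qed

text \<open>
Particle \<open>i\<close> leaves a vertex and then particle \<open>j\<close> arrives at another one.  In the opposite order,
\<open>j\<close> arrives while \<open>i\<close> is still at its vertex: \<open>j\<close> is the first particle on its edge already in
\<open>x\<close>, since \<open>i\<close> can only be met at the other end of that edge.
\<close>

lemma square_up_down:
  assumes a: "up x a y" and b: "up z b y" and ab: "independent a b"
  shows "\<exists>y'. up y' b x \<and> up y' a z"
proof -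
  obtain i A B where ai: "a = (i, A, B)" by (cases a) auto
  obtain j C D where bj: "b = (j, C, D)" by (cases b) auto
  have ij: "i < N" "j < N" "i \<noteq> j" "A \<noteq> C" using a b ab by (auto simp: up_def independent_def ai bj)
  have Conf: "x \<in> Conf" "y \<in> Conf" "z \<in> Conf" "below x y" "below z y" using a b by (auto simp: up_def)
  obtain v where v: "A = {v}" using up_vertex[OF a] ai by auto
  obtain v' where v': "C = {v'}" "v' \<in> D" using up_vertex[OF b] bj by auto
  have s: "supp (x i) = {v}" "supp (y i) = B" "supp (z i) = B" "supp (z j) = {v'}"
    "supp (y j) = D" "supp (x j) = D"
    using a b ij v v' by (auto simp: up_def ai bj)
  have s': "supp (x k) = supp (y k)" "supp (z k) = supp (y k)" if "k < N" "k \<noteq> i" "k \<noteq> j" for k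
    using a b that by (auto simp: up_def ai bj)
  let ?p = "z j"
  let ?o = "x(j := ?p)"
  have p: "?p \<in> P" using Conf_point Conf ij by blast
  have free: "x l \<noteq> ?p" if l: "l < N" "l \<noteq> j" for l
  proof
    assume eq: "x l = ?p"
    show False
    proof (cases "l = i")
      case True
      then show ?thesis using eq s v v' ij by auto
    next
      case False
      then have "supp (z l) = {v'}" using s' l eq s by metis
      then show ?thesis using Conf_vertex_neq[OF Conf(3) l(1) ij(2)] s l by auto
    qed
  qed
  have first: "x l v' < x j v'" if l: "l < N" "l \<noteq> j" "supp (x j) \<union> supp (x l) \<subseteq> {v', w}" for l w
  proof (cases "l = i")
    case True
    then have "x l v' = 0" using vertex_value(2)[OF Conf_point[OF Conf(1) ij(1)] s(1)] ij v v' by auto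
    moreover have "x j v' > 0"
      using nonneg[OF Conf_point[OF Conf(1) ij(2)], of v'] v'(2) s(6) by (auto simp: supp_def less_le)
    ultimately show ?thesis by simp
  next
    case False
    then have w: "supp (y j) \<union> supp (y l) \<subseteq> {v', w}" using l s s' by auto
    then have "y l v' < y j v'" using below_vertex_first[OF Conf(3,2,5) ij(2) s(4) l(1,2)] by blast
    moreover have "common_edge (y l) (y j)" using w by (auto simp: common_edge_def)
    ultimately show ?thesis using below_order[OF Conf(4) l(1) ij(2), of v'] by simp
  qed
  have "v' \<in> supp (x j)" using s v' by simp
  note n = nearest_to_vertex[OF Conf(1) ij(2) p s(4) this free first]
  have oC: "?o \<in> Conf" "below ?o x" using n by auto
  have *: "(?p u < x l u \<longleftrightarrow> ?p u < z l u) \<and> (x l u < ?p u \<longleftrightarrow> z l u < ?p u)"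
    if l: "l < N" "l \<noteq> j" and J: "common_edge ?p (z l)" for l u
  proof -
    obtain w where w: "supp ?p \<union> supp (z l) \<subseteq> {v', w}"
      using common_edge_at_vertex[OF J, of v'] s(4) by auto
    have "supp (x l) \<subseteq> supp (z l)"
      using s s' l below_supp[OF Conf(4) l(1)] by (cases "l = i") auto
    then have sub: "supp (x l) \<subseteq> {v', w}" "supp (z l) \<subseteq> {v', w}" using w by auto
    show ?thesis
      using vertex_extreme[OF p s(4) Conf_point[OF Conf(1) l(1)] sub(1) free[OF l], of u]
        vertex_extreme[OF p s(4) Conf_point[OF Conf(3) l(1)] sub(2) Conf_neq[OF Conf(3) l(1) ij(2) l(2)], of u] by simp
  qed
  have sz: "supp (?o k) \<subseteq> supp (z k)" if "k < N" for k
    using that s s' below_supp[OF Conf(4) that] by (cases "k = i"; cases "k = j") auto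
  have "below ?o z"
    unfolding below_def
  proof (intro conjI allI impI sz)
    fix k l u assume kl: "k < N" "l < N" "common_edge (z k) (z l)"
    show "?o k u < ?o l u \<longleftrightarrow> z k u < z l u"
    proof (cases "k = j \<or> l = j")
      case True
      then show ?thesis using *[of l u] *[of k u] kl by (auto simp: common_edge_def Un_commute)
    next
      case False
      then have "supp (z k) = supp (y k)" "supp (z l) = supp (y l)"
        using s s' kl by (metis)+
      then have "common_edge (y k) (y l)" using kl by (simp add: common_edge_def)
      then show ?thesis
        using False below_order[OF Conf(4) kl(1,2), of u] below_order[OF Conf(5) kl(1,2), of u] by simp
    qed
  qed
  then have "up ?o b x" "up ?o a z"
    using oC Conf ij s s' a b v v' unfolding up_def ai bj by auto
  then show ?thesis by blast
qed

text \<open>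
From \<open>y\<close>, both \<open>x\<close> and \<open>z\<close> are reached by a particle leaving its vertex.  The fourth corner of the
square performs both departures, but only a short way, so that it stays in the star of \<open>y\<close>; its
order on the edges then agrees with those of \<open>x\<close> and \<open>z\<close>.
\<close>

lemma square_down_up:
  assumes a: "up y a x" and b: "up y b z" and ab: "independent a b"
  shows "\<exists>y'. up x b y' \<and> up z a y'"
proof -
  obtain i A B where ai: "a = (i, A, B)" by (cases a) auto
  obtain j C D where bj: "b = (j, C, D)" by (cases b) auto
  have ij: "i < N" "j < N" "i \<noteq> j" using a b ab by (auto simp: up_def independent_def ai bj)
  have Conf: "x \<in> Conf" "y \<in> Conf" "z \<in> Conf" "below y x" "below y z" using a b by (auto simp: up_def)
  define m where "m t = (\<lambda>k. if k = j then seg y z t k else seg y x t k)" for t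
  obtain U where U: "open U" "y \<in> U" "\<forall>y'\<in>U. (\<forall>i<N. y' i \<in> P) \<longrightarrow> y' \<in> Conf \<and> below y y'"
    using below_nbhd[OF Conf(2)] by blast
  have "continuous_on UNIV m"
  proof (intro continuous_on_coordinatewise_then_product)
    fix k v
    show "continuous_on UNIV (\<lambda>t. m t k v)"
      unfolding m_def seg_def by (cases "k = j") (auto intro!: continuous_intros)
  qed
  then have "open (m -` U)" using U(1) by (simp add: open_vimage)
  moreover
  have "m 0 = y" by (auto simp: m_def fun_eq_iff)
  then have "0 \<in> m -` U" using U(2) by simp
  ultimately obtain e where e: "e > 0" "ball 0 e \<subseteq> m -` U" using open_contains_ball by blast
  \<comment> \<open>so short a way that the configuration stays in the neighbourhood U of y\<close>
  define t where "t = min (e / 2) 1"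
  have t: "0 < t" "t \<le> 1" "m t \<in> U"
    using e by (auto simp: t_def subset_iff)
  have sx: "supp (m t k) = supp (x k)" if "k < N" "k \<noteq> j" for k
    using seg_supp[OF Conf(2,1,4), of t k] t that by (simp add: m_def)
  have sz: "supp (m t j) = supp (z j)"
    using seg_supp[OF Conf(2,3,5), of t j] t ij by (simp add: m_def)
  have "m t k \<in> P" if "k < N" for k
    using Conf_point[OF seg_in_Conf[OF Conf(2,1,4), of t] that] Conf_point[OF seg_in_Conf[OF Conf(2,3,5), of t] that] t
    by (cases "k = j") (simp_all add: m_def)
  then have mC: "m t \<in> Conf" "below y (m t)" using U(3) t by auto
  have s: "supp (y i) = A" "supp (x i) = B" "supp (z i) = A" "supp (y j) = C" "supp (x j) = C"
    "supp (z j) = D"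
    using a b ij by (auto simp: up_def ai bj)
  have s': "supp (x k) = supp (y k)" "supp (z k) = supp (y k)" if "k < N" "k \<noteq> i" "k \<noteq> j" for k
    using a b that by (auto simp: up_def ai bj)
  have "below x (m t)"
  proof (rule below_sandwich[OF Conf(4) mC(2)])
    fix k assume k: "k < N"
    then show "supp (x k) \<subseteq> supp (m t k)"
      using sx sz s below_supp[OF Conf(5), of j] by (cases "k = j") auto
  qed
  moreover have "below z (m t)"
  proof (rule below_sandwich[OF Conf(5) mC(2)])
    fix k assume k: "k < N"
    then show "supp (z k) \<subseteq> supp (m t k)"
      using sx sz s s' below_supp[OF Conf(4), of i] by (cases "k = j"; cases "k = i") auto
  qed
  ultimately have "up x b (m t)" "up z a (m t)"
    using mC Conf ij s s' sx sz a b unfolding up_def ai bj by auto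
  then show ?thesis by blast
qed

text \<open>
The lowest of the four corners has all of them in its star, so both ways around the square are
homotopic.
\<close>

lemma square:
  assumes a: "step x a y" and b: "step y b z" and ab: "independent a b"
  shows "\<exists>y'. step x b y' \<and> step y' a z \<and>
    homotopic_paths Conf (seg x y +++ seg y z) (seg x y' +++ seg y' z)"
proof -
  have *: "homotopic_paths Conf (seg x y +++ seg y z) (seg x y' +++ seg y' z)"
    if "step x b y'" "step y' a z" "m \<in> Conf" "below m x" "below m y" "below m z" "below m y'" for y' m
  proof (rule star_homotopic[of m])
    have st: "x \<in> star m" "y \<in> star m" "z \<in> star m" "y' \<in> star m"
      using that step_Conf[OF a] step_Conf[OF b] step_Conf by (auto simp: star_def)
    show "path_image (seg x y +++ seg y z) \<subseteq> star m"
      using seg_in_star st step_below a b by (intro subset_path_image_join) auto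
    show "path_image (seg x y' +++ seg y' z) \<subseteq> star m"
      using seg_in_star st step_below that by (intro subset_path_image_join) auto
  qed (use that in auto)
  from a b consider "up x a y" "up y b z" | "up x a y" "up z b y" | "up y a x" "up y b z"
    | "up y a x" "up z b y"
    by (auto simp: step_def)
  then show ?thesis
  proof cases
    case 1
    obtain y' where y': "up x b y'" "up y' a z" using square_up_up[OF 1 ab] by blast
    have l: "x \<in> Conf" "below x y" "below y z" "below x y'" using 1 y' by (simp_all add: up_def)
    have t: "below x z" using l below_trans by metis+
    show ?thesis
      by (rule exI[of _ y'], intro conjI *[of y' x]) (use 1 y' l t in \<open>simp_all add: step_def\<close>)
  next
    case 2
    obtain y' where y': "up y' b x" "up y' a z" using square_up_down[OF 2 ab] by blast
    have l: "y' \<in> Conf" "below y' x" "below y' z" "below x y" using 2 y' by (simp_all add: up_def)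
    have t: "below y' y" using l below_trans by metis+
    show ?thesis
      by (rule exI[of _ y'], intro conjI *[of y' y']) (use 2 y' l t in \<open>simp_all add: step_def\<close>)
  next
    case 3
    obtain y' where y': "up x b y'" "up z a y'" using square_down_up[OF 3 ab] by blast
    have l: "y \<in> Conf" "below y x" "below y z" "below x y'" using 3 y' by (simp_all add: up_def)
    have t: "below y y'" using l below_trans by metis+
    show ?thesis
      by (rule exI[of _ y'], intro conjI *[of y' y]) (use 3 y' l t in \<open>simp_all add: step_def\<close>)
  next
    case 4
    obtain y' where y': "up z a y'" "up y' b x"
      using square_up_up[OF 4(2,1) independent_sym[OF ab]] by blast
    have l: "z \<in> Conf" "below z y" "below y x" "below z y'" using 4 y' by (simp_all add: up_def)
    have t: "below z x" using l below_trans by metis+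
    show ?thesis
      by (rule exI[of _ y'], intro conjI *[of y' z]) (use 4 y' l t in \<open>simp_all add: step_def\<close>)
  qed
qed

text \<open>
Equal letters must be traversed in opposite directions, because a particle that has entered the edge
is no longer at the vertex.  So all particles are on the same faces in \<open>x\<close> and \<open>z\<close>.  They are also in the
same order: if \<open>y\<close> is below, both inherit its order; if \<open>y\<close> is above, the moving particle is at a
vertex in \<open>x\<close> and \<open>z\<close>, hence at the end of each edge there, and the others are in the order of \<open>y\<close>.
\<close>

lemma backtrack:
  assumes a: "step x a y" and b: "step y a z"
  shows "same_stratum x z \<and> homotopic_paths Conf (seg x y +++ seg y z) (seg x z)"
proof -
  have homotopic: "homotopic_paths Conf (seg x y +++ seg y z) (seg x z)"
    if "same_stratum x z" "m \<in> Conf" "below m x" "below m y" "below m z" for m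
  proof (rule star_homotopic[of m])
    have st: "x \<in> star m" "y \<in> star m" "z \<in> star m"
      using that step_Conf[OF a] step_Conf[OF b] by (auto simp: star_def)
    show "path_image (seg x y +++ seg y z) \<subseteq> star m"
      using seg_in_star st step_below a b by (intro subset_path_image_join) auto
    show "path_image (seg x z) \<subseteq> star m"
      using seg_in_star st that(1) by (auto simp: same_stratum_def)
  qed (use that in auto)
  obtain i A B where ai: "a = (i, A, B)" by (cases a) auto
  have "\<not> (up u a y \<and> up y a u')" for u u'
    unfolding up_def by metis
  then consider "up x a y" "up z a y" | "up y a x" "up y a z"
    using a b by (auto simp: step_def)
  then show ?thesis
  proof cases
    case 1
    obtain v where v: "A = {v}" using up_vertex[OF 1(1)] ai by auto
    have Conf: "x \<in> Conf" "z \<in> Conf" "y \<in> Conf" "below x y" "below z y" and i: "i < N" using 1 by (auto simp: up_def ai)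
    have s: "supp (x i) = {v}" "supp (z i) = {v}" using 1 v by (auto simp: up_def ai)
    have s': "supp (x k) = supp (y k)" "supp (z k) = supp (y k)" if "k < N" "k \<noteq> i" for k
      using 1 that by (auto simp: up_def ai)
    have xz: "x i = z i"
      using edge_eq[of "x i" "z i" v v] vertex_value(1)[OF Conf_point[OF Conf(1) i] s(1)]
      vertex_value(1)[OF Conf_point[OF Conf(2) i] s(2)] s Conf_point[OF Conf(1) i] Conf_point[OF Conf(2) i] by simp
    have *: "(x i u < x l u \<longleftrightarrow> z i u < z l u) \<and> (x l u < x i u \<longleftrightarrow> z l u < z i u)"
      if l: "l < N" "l \<noteq> i" and J: "common_edge (z i) (z l)" for l u
    proof -
      obtain w where w: "supp (z i) \<union> supp (z l) \<subseteq> {v, w}"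
        using common_edge_at_vertex[OF J, of v] s by auto
      then have sub: "supp (x l) \<subseteq> {v, w}" "supp (z l) \<subseteq> {v, w}" using s' l by auto
      show ?thesis
        using vertex_extreme[OF Conf_point[OF Conf(1) i] s(1) Conf_point[OF Conf(1) l(1)] sub(1) Conf_neq[OF Conf(1) l(1) i l(2)], of u]
          vertex_extreme[OF Conf_point[OF Conf(2) i] s(2) Conf_point[OF Conf(2) l(1)] sub(2) Conf_neq[OF Conf(2) l(1) i l(2)], of u]
        by simp
    qed
    have **: "x k u < x l u \<longleftrightarrow> z k u < z l u"
      if kl: "k < N" "l < N" "common_edge (z k) (z l)" for k l u
    proof (cases "k = i \<or> l = i")
      case True
      then show ?thesis using *[of l u] *[of k u] kl by (auto simp: common_edge_def Un_commute)
    next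
      case False
      then have "common_edge (y k) (y l)" using kl s' by (simp add: common_edge_def)
      then show ?thesis
        using False below_order[OF Conf(4) kl(1,2), of u] below_order[OF Conf(5) kl(1,2), of u] by simp
    qed
    have ss: "supp (x k) = supp (z k)" if "k < N" for k
      using s s' that by (cases "k = i") auto
    have "below x z" using ** ss by (auto simp: below_def)
    moreover have "below z x" using ** ss by (auto simp: below_def common_edge_def)
    ultimately have "same_stratum x z" using Conf by (auto simp: same_stratum_def)
    then show ?thesis using homotopic[of x] Conf by (auto simp: same_stratum_def)
  next
    case 2
    have "supp (x k) = supp (z k)" if "k < N" for k
      using 2 that by (cases "k = i") (auto simp: up_def ai)
    then have "same_stratum x z"
      using 2 below_sandwich[of y x z] below_sandwich[of y z x] by (auto simp: same_stratum_def up_def)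
    then show ?thesis using homotopic[of y] 2 by (auto simp: up_def)
  qed
qed

section \<open>Paths as words of elementary moves\<close>


text \<open>
\<open>realizes w x g y\<close>: the path \<open>g\<close> from \<open>x\<close> to \<open>y\<close> is homotopic to a piecewise straight path that
performs the moves \<open>w\<close>.  For the empty word, a straight path inside one stratum is allowed, because
the intermediate positions within the strata are arbitrary.
\<close>

primrec realizes :: "'v letter list \<Rightarrow> (nat \<Rightarrow> 'v \<Rightarrow> real) \<Rightarrow> (real \<Rightarrow> nat \<Rightarrow> 'v \<Rightarrow> real) \<Rightarrow>
    (nat \<Rightarrow> 'v \<Rightarrow> real) \<Rightarrow> bool" where
  "realizes [] x g y \<longleftrightarrow> same_stratum x y \<and> homotopic_paths Conf g (seg x y)"
| "realizes (a # w) x g y \<longleftrightarrow>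
     (\<exists>z h. step x a z \<and> realizes w z h y \<and> homotopic_paths Conf g (seg x z +++ h))"

lemma realizes_path:
  assumes "realizes w x g y"
  shows "path g" "path_image g \<subseteq> Conf" "pathstart g = x" "pathfinish g = y"
proof -
  have "path g \<and> path_image g \<subseteq> Conf \<and> pathstart g = x \<and> pathfinish g = y"
    using assms
  proof (induction w arbitrary: x g)
    case Nil
    then have h: "homotopic_paths Conf g (seg x y)" by simp
    show ?case
      using homotopic_paths_imp_path[OF h] homotopic_paths_imp_subset[OF h]
        homotopic_paths_imp_pathstart[OF h] homotopic_paths_imp_pathfinish[OF h] by simp
  next
    case (Cons a w)
    then obtain z h where z: "realizes w z h y" "homotopic_paths Conf g (seg x z +++ h)" by auto
    show ?case
      using homotopic_paths_imp_path[OF z(2)] homotopic_paths_imp_subset[OF z(2)]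
        homotopic_paths_imp_pathstart[OF z(2)] homotopic_paths_imp_pathfinish[OF z(2)]
        Cons.IH[OF z(1)] by simp
  qed
  then show "path g" "path_image g \<subseteq> Conf" "pathstart g = x" "pathfinish g = y" by auto
qed

lemma seg_image_Conf:
  assumes "x \<in> Conf" "y \<in> Conf" "below x y \<or> below y x"
  shows "path_image (seg x y) \<subseteq> Conf"
  using assms seg_in_star[of x x y] seg_in_star[of x y y] by (auto simp: star_def)

lemma realizes_homotopic:
  "realizes w x g y \<Longrightarrow> homotopic_paths Conf g' g \<Longrightarrow> realizes w x g' y"
  by (cases w) (auto intro: homotopic_paths_trans)

lemma seg_join:
  assumes "m \<in> Conf" "x \<in> star m" "y \<in> star m" "z \<in> star m"
    "below x y \<or> below y x" "below y z \<or> below z y" "below x z \<or> below z x"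
  shows "homotopic_paths Conf (seg x y +++ seg y z) (seg x z)"
  using assms
  by (intro star_homotopic[of m] subset_path_image_join seg_in_star) auto

lemma join_seg_cong:
  assumes "homotopic_paths Conf (seg x y +++ seg y z) (seg x z)"
    "path h" "path_image h \<subseteq> Conf" "pathstart h = z"
    "path_image (seg x y) \<subseteq> Conf" "path_image (seg y z) \<subseteq> Conf"
  shows "homotopic_paths Conf (seg x y +++ (seg y z +++ h)) (seg x z +++ h)"
proof -
  have "homotopic_paths Conf (seg x y +++ (seg y z +++ h)) ((seg x y +++ seg y z) +++ h)"
    using assms by (intro homotopic_paths_assoc) auto
  also have "homotopic_paths Conf \<dots> (seg x z +++ h)"
    using assms by (intro homotopic_paths_join) auto
  finally show ?thesis .
qed

lemma realizes_prepend_same_stratum: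
  assumes "same_stratum x' x" "realizes w x g y"
  shows "realizes w x' (seg x' x +++ g) y"
proof (cases w)
  case Nil
  then have xy: "same_stratum x y" and g: "homotopic_paths Conf g (seg x y)" using assms by auto
  have s: "x' \<in> Conf" "x \<in> Conf" "y \<in> Conf" "below x' x" "below x x'" "below x y" "below y x"
    using assms(1) xy by (simp_all add: same_stratum_def)
  then have "below x' y" using below_trans by metis
  have "homotopic_paths Conf (seg x' x +++ g) (seg x' x +++ seg x y)"
    using g s homotopic_paths_imp_pathstart[OF g]
    by (intro homotopic_paths_join) (simp_all add: seg_image_Conf)
  also have "homotopic_paths Conf \<dots> (seg x' y)"
    using s \<open>below x' y\<close> by (intro seg_join[of x']) (auto simp: star_def)
  finally show ?thesis using Nil same_stratum_trans[OF assms(1) xy] by simp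
next
  case (Cons a v)
  then obtain z h where z: "step x a z" "realizes v z h y" "homotopic_paths Conf g (seg x z +++ h)"
    using assms by auto
  have s: "x' \<in> Conf" "x \<in> Conf" "z \<in> Conf" "below x' x" "below x x'" "below x z \<or> below z x"
    using assms(1) step_Conf[OF z(1)] step_below[OF z(1)] by (auto simp: same_stratum_def)
  then have xz: "below x' z \<or> below z x'" using below_trans by metis
  have "step x' a z"
    using step_same_stratum[OF z(1) same_stratum_sym[OF assms(1)]] s by (auto simp: same_stratum_def)
  moreover have "homotopic_paths Conf (seg x' x +++ g) (seg x' z +++ h)"
  proof -
    have "homotopic_paths Conf (seg x' x +++ g) (seg x' x +++ (seg x z +++ h))"
      using s z(3) homotopic_paths_imp_pathstart[OF z(3)]
      by (intro homotopic_paths_join) (simp_all add: seg_image_Conf)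
    also have "homotopic_paths Conf \<dots> (seg x' z +++ h)"
    proof (rule join_seg_cong)
      show "homotopic_paths Conf (seg x' x +++ seg x z) (seg x' z)"
      proof (cases "below x z")
        case True
        then show ?thesis using s xz below_trans[of x' x z] by (intro seg_join[of x']) (auto simp: star_def)
      next
        case False
        then have "below z x" using s by blast
        then show ?thesis using s xz below_trans[of z x x'] by (intro seg_join[of z]) (auto simp: star_def)
      qed
    qed (use s realizes_path[OF z(2)] in \<open>simp_all add: seg_image_Conf\<close>)
    finally show ?thesis .
  qed
  ultimately show ?thesis using Cons z by auto
qed

lemma realizes_append:
  "realizes u x g y \<Longrightarrow> realizes w y h z \<Longrightarrow> realizes (u @ w) x (g +++ h) z"
proof (induction u arbitrary: x g)
  case Nil
  then have xy: "same_stratum x y" and g: "homotopic_paths Conf g (seg x y)" by auto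
  have "homotopic_paths Conf (g +++ h) (seg x y +++ h)"
    using g realizes_path[OF Nil(2)] homotopic_paths_imp_pathfinish[OF g]
    by (intro homotopic_paths_join) auto
  then show ?case
    using realizes_homotopic realizes_prepend_same_stratum[OF xy Nil(2)] by simp
next
  case (Cons a u)
  then obtain x1 k where k: "step x a x1" "realizes u x1 k y" "homotopic_paths Conf g (seg x x1 +++ k)"
    by auto
  have "realizes (u @ w) x1 (k +++ h) z" using Cons k by blast
  moreover have "homotopic_paths Conf (g +++ h) (seg x x1 +++ (k +++ h))"
  proof -
    have "homotopic_paths Conf (g +++ h) ((seg x x1 +++ k) +++ h)"
      using k realizes_path[OF k(2)] realizes_path[OF Cons.prems(2)] homotopic_paths_imp_pathfinish[OF k(3)]
      by (intro homotopic_paths_join) auto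
    also have "homotopic_paths Conf \<dots> (seg x x1 +++ (k +++ h))"
      using k realizes_path[OF k(2)] realizes_path[OF Cons.prems(2)]
        seg_image_Conf[of x x1] step_Conf[OF k(1)] step_below[OF k(1)]
      by (subst homotopic_paths_sym_eq, intro homotopic_paths_assoc) auto
    finally show ?thesis .
  qed
  ultimately show ?case using k(1) by auto
qed

lemma realizes_step:
  assumes "step x a y"
  shows "realizes [a] x (seg x y) y"
proof -
  obtain m where m: "m \<in> Conf" "x \<in> star m" "y \<in> star m"
    using step_Conf[OF assms] step_below[OF assms] by (auto simp: star_def)
  have "homotopic_paths Conf (seg x y +++ seg y y) (seg x y)"
    by (rule seg_join[OF m m(3)]) (use step_below[OF assms] in auto)
  then have h: "homotopic_paths Conf (seg x y) (seg x y +++ seg y y)" using homotopic_paths_sym by blast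
  have y: "y \<in> Conf" using step_Conf[OF assms] by blast
  have "homotopic_paths Conf (seg y y) (seg y y)"
    using seg_image_Conf[OF y y] by (simp del: seg_same)
  with y have "realizes [] y (seg y y) y" unfolding realizes.simps by (simp only: same_stratum_def below_refl simp_thms)
  with h assms show ?thesis unfolding realizes.simps(2) by blast
qed

lemma realizes_reverse:
  "realizes w x g y \<Longrightarrow> realizes (rev w) y (reversepath g) x"
proof (induction w arbitrary: x g)
  case Nil
  then show ?case using homotopic_paths_reversepath[of Conf g "seg x y"] same_stratum_sym by auto
next
  case (Cons a w)
  then obtain z h where z: "step x a z" "realizes w z h y" "homotopic_paths Conf g (seg x z +++ h)" by auto
  have "realizes (rev w @ [a]) y (reversepath h +++ seg z x) x"
    using realizes_append[OF Cons.IH[OF z(2)] realizes_step[of z a x]] z(1) step_sym by blast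
  moreover have "homotopic_paths Conf (reversepath g) (reversepath h +++ seg z x)"
    using homotopic_paths_reversepath[of Conf g "seg x z +++ h"] z(3) realizes_path[OF z(2)]
    by (simp add: reversepath_joinpaths)
  ultimately show ?case using realizes_homotopic by simp
qed

text \<open>
The particles that are at vertices in \<open>x\<close>, but not in \<open>y\<close>, depart one after the other.
\<close>

lemma realizes_below:
  assumes "x \<in> Conf" "y \<in> Conf" "below x y"
  shows "\<exists>w. realizes w x (seg x y) y"
  using assms
proof (induction "card {i. i < N \<and> supp (x i) \<noteq> supp (y i)}" arbitrary: y)
  case 0
  then have eq: "supp (x i) = supp (y i)" if "i < N" for i using that by auto
  then have "below y x" using below_sandwich[of x y x] 0 by simp
  then have "realizes [] x (seg x y) y"
    using 0 seg_image_Conf[of x y] by (simp add: same_stratum_def)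
  then show ?case by blast
next
  case (Suc n)
  let ?D = "\<lambda>y. {i. i < N \<and> supp (x i) \<noteq> supp (y i)}"
  obtain i where i: "i < N" "supp (x i) \<noteq> supp (y i)"
    using Suc(2) by (metis (mono_tags, lifting) Collect_empty_eq card.empty nat.distinct(1))
  then have "supp (x i) \<subset> supp (y i)" using below_supp[of x y i] Suc by blast
  then obtain v where v: "supp (x i) = {v}"
    using proper_face Conf_point[OF Suc(3) i(1)] Conf_point[OF Suc(4) i(1)] by metis
  let ?y = "y(i := x i)"
  note r = retract_particle[OF Suc(3-5) i(1) v]
  have "?D ?y = ?D y - {i}" by auto
  moreover have "i \<in> ?D y" using i by blast
  ultimately have "card (?D ?y) = n" using Suc(2) by simp
  then obtain w where w: "realizes w x (seg x ?y) ?y" using Suc(1)[of ?y] r Suc(3) by auto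
  have "up ?y (i, supp (x i), supp (y i)) y"
    using r Suc(4) i by (auto simp: up_def)
  then have "realizes (w @ [(i, supp (x i), supp (y i))]) x (seg x ?y +++ seg ?y y) y"
    using realizes_append[OF w realizes_step] by (auto simp: step_def)
  moreover have "homotopic_paths Conf (seg x ?y +++ seg ?y y) (seg x y)"
    using r Suc(3-5) by (intro seg_join[of x]) (auto simp: star_def)
  ultimately show ?case using realizes_homotopic homotopic_paths_sym by blast
qed

text \<open>
By bisection it suffices to consider a path in the star of one of its points \<open>z\<close>.  It is homotopic to
the straight path to \<open>z\<close> followed by the straight path to its end.
\<close>

lemma realizes_exists:
  assumes g: "path g" "path_image g \<subseteq> Conf"
  shows "\<exists>w. realizes w (pathstart g) g (pathfinish g)"
proof -
  define Q where "Q a b \<longleftrightarrow> (0 \<le> a \<and> b \<le> 1 \<longrightarrow> (\<exists>w. realizes w (g a) (g \<circ> linepath a b) (g b)))" for a b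
  have gC: "g t \<in> Conf" if "0 \<le> t" "t \<le> 1" for t using g(2) that by (auto simp: path_image_def)
  have seg01: "path (g \<circ> linepath a b)" "path_image (g \<circ> linepath a b) \<subseteq> g ` {a..b}"
    if "0 \<le> a" "a \<le> b" "b \<le> 1" for a b :: real
  proof -
    have "path_image (linepath a b) = {a..b}" using that by (simp add: closed_segment_eq_real_ivl)
    moreover from this have "continuous_on (path_image (linepath a b)) g"
      using g(1) that unfolding path_def by (auto intro: continuous_on_subset)
    ultimately show "path (g \<circ> linepath a b)" "path_image (g \<circ> linepath a b) \<subseteq> g ` {a..b}"
      by (auto intro: path_continuous_image simp: path_image_compose)
  qed
  have "(0::real) \<le> 1" by simp
  then have "Q 0 1"
  proof (induction rule: Bolzano)
    case (trans a b c)
    show ?case unfolding Q_def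
    proof
      assume ac: "0 \<le> a \<and> c \<le> 1"
      with trans obtain u w where "realizes u (g a) (g \<circ> linepath a b) (g b)"
        "realizes w (g b) (g \<circ> linepath b c) (g c)" by (auto simp: Q_def)
      then have uw: "realizes (u @ w) (g a) ((g \<circ> linepath a b) +++ (g \<circ> linepath b c)) (g c)"
        by (rule realizes_append)
      have "homotopic_paths {0..1} (linepath a c) (linepath a b +++ linepath b c)"
      proof (rule homotopic_paths_linear)
        fix t :: real assume t: "t \<in> {0..1}"
        have "path_image (linepath a b +++ linepath b c) \<subseteq> {0..1}"
          using ac trans by (intro subset_path_image_join) (auto simp: closed_segment_eq_real_ivl)
        moreover have "path_image (linepath a c) \<subseteq> {0..1}"
          using ac trans by (auto simp: closed_segment_eq_real_ivl)
        ultimately have "linepath a c t \<in> {0..1}" "(linepath a b +++ linepath b c) t \<in> {0..1}"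
          using t unfolding path_image_def by blast+
        then show "closed_segment (linepath a c t) ((linepath a b +++ linepath b c) t) \<subseteq> {0..1}"
          by (intro closed_segment_subset) auto
      qed auto
      then have "homotopic_paths Conf (g \<circ> linepath a c) (g \<circ> (linepath a b +++ linepath b c))"
        using g(1) gC by (intro homotopic_paths_continuous_image[of "{0..1}"]) (auto simp: path_def)
      then have "homotopic_paths Conf (g \<circ> linepath a c) ((g \<circ> linepath a b) +++ (g \<circ> linepath b c))"
        by (simp add: path_compose_join)
      then show "\<exists>w. realizes w (g a) (g \<circ> linepath a c) (g c)"
        using realizes_homotopic[OF uw] by blast
    qed
  next
    case (local x)
    let ?z = "g x"
    have z: "?z \<in> Conf" using gC local by blast
    obtain U where U: "open U" "?z \<in> U" "\<forall>y\<in>U. (\<forall>i<N. y i \<in> P) \<longrightarrow> y \<in> Conf \<and> below ?z y"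
      using below_nbhd[OF z] by blast
    obtain V where V: "open V" "V \<inter> {0..1} = g -` U \<inter> {0..1}"
      using g(1) U(1) unfolding path_def by (metis continuous_on_open_invariant)
    have "x \<in> V" using V(2) U(2) local by auto
    then obtain d where d: "d > 0" "ball x d \<subseteq> V" using V(1) open_contains_ball by blast
    have "Q a b" if ab: "a \<le> x \<and> x \<le> b \<and> b - a < d" for a b
      unfolding Q_def
    proof
      assume 01: "0 \<le> a \<and> b \<le> 1"
      have st: "g t \<in> star ?z" if "t \<in> {a..b}" for t
      proof -
        have "t \<in> V" using d(2) that ab by (auto simp: subset_iff dist_real_def)
        then have "g t \<in> U" using V(2) that 01 by auto
        moreover have "g t \<in> Conf" using gC that 01 by auto
        ultimately show ?thesis using bspec[OF U(3), of "g t"] Conf_point by (simp add: star_def)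
      qed
      have ab': "g a \<in> Conf" "g b \<in> Conf" "below ?z (g a)" "below ?z (g b)"
        using st[of a] st[of b] ab by (auto simp: star_def)
      obtain u w where u: "realizes u ?z (seg ?z (g a)) (g a)" and w: "realizes w ?z (seg ?z (g b)) (g b)"
        using realizes_below z ab' by blast
      have uw: "realizes (rev u @ w) (g a) (seg (g a) ?z +++ seg ?z (g b)) (g b)"
        using realizes_append[OF realizes_reverse[OF u] w] by simp
      have "homotopic_paths Conf (g \<circ> linepath a b) (seg (g a) ?z +++ seg ?z (g b))"
      proof (rule star_homotopic[OF z])
        show "path (g \<circ> linepath a b)" using seg01 01 ab by auto
        show "path_image (g \<circ> linepath a b) \<subseteq> star ?z" using seg01(2)[of a b] 01 ab st by auto
        show "path_image (seg (g a) ?z +++ seg ?z (g b)) \<subseteq> star ?z"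
          using z ab' by (intro subset_path_image_join seg_in_star) (auto simp: star_def)
      qed (auto simp: pathstart_compose pathfinish_compose)
      then show "\<exists>w. realizes w (g a) (g \<circ> linepath a b) (g b)"
        using realizes_homotopic[OF uw] by blast
    qed
    with d(1) show ?case by blast
  qed
  moreover have "g \<circ> linepath 0 1 = g" by (auto simp: linepath_def)
  ultimately show ?thesis by (simp add: Q_def pathstart_def pathfinish_def)
qed

lemma realizes_shuffle:
  assumes "independent a b"
  shows "realizes (u @ [a, b] @ w) x g y \<Longrightarrow> realizes (u @ [b, a] @ w) x g y"
proof (induction u arbitrary: x g)
  case Nil
  then obtain z1 h1 z2 h where h: "step x a z1" "step z1 b z2" "realizes w z2 h y"
    "homotopic_paths Conf h1 (seg z1 z2 +++ h)" "homotopic_paths Conf g (seg x z1 +++ h1)" by auto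
  obtain z' where z': "step x b z'" "step z' a z2"
    "homotopic_paths Conf (seg x z1 +++ seg z1 z2) (seg x z' +++ seg z' z2)"
    using square[OF h(1,2) assms] by blast
  have im: "path_image (seg p q) \<subseteq> Conf" if "step p c q" for p c q
    using seg_image_Conf step_Conf[OF that] step_below[OF that] by blast
  note hp = realizes_path[OF h(3)]
  have "homotopic_paths Conf g (seg x z1 +++ h1)" by fact
  also have "homotopic_paths Conf \<dots> (seg x z1 +++ (seg z1 z2 +++ h))"
    using h(4) im[OF h(1)] homotopic_paths_imp_pathstart[OF h(4)] by (intro homotopic_paths_join) auto
  also have "homotopic_paths Conf \<dots> ((seg x z1 +++ seg z1 z2) +++ h)"
    using hp im[OF h(1)] im[OF h(2)] by (intro homotopic_paths_assoc) auto
  also have "homotopic_paths Conf \<dots> ((seg x z' +++ seg z' z2) +++ h)"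
    by (rule homotopic_paths_join) (use hp z'(3) in auto)
  also have "homotopic_paths Conf \<dots> (seg x z' +++ (seg z' z2 +++ h))"
    using hp im[OF z'(1)] im[OF z'(2)]
    by (subst homotopic_paths_sym_eq, intro homotopic_paths_assoc) auto
  finally have "homotopic_paths Conf g (seg x z' +++ (seg z' z2 +++ h))" .
  moreover have "homotopic_paths Conf (seg z' z2 +++ h) (seg z' z2 +++ h)"
    using hp im[OF z'(2)] by (simp add: subset_path_image_join)
  ultimately have "realizes (a # w) z' (seg z' z2 +++ h) y"
    using z'(2) h(3) unfolding realizes.simps by blast
  with z'(1) \<open>homotopic_paths Conf g (seg x z' +++ (seg z' z2 +++ h))\<close>
  show ?case unfolding append.simps realizes.simps(2)[of b] by blast
next
  case (Cons c u)
  then show ?case unfolding append.simps realizes.simps by blast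
qed

lemma realizes_cancel:
  "realizes (u @ [a, a] @ w) x g y \<Longrightarrow> realizes (u @ w) x g y"
proof (induction u arbitrary: x g)
  case Nil
  then obtain z1 h1 z2 h where h: "step x a z1" "step z1 a z2" "realizes w z2 h y"
    "homotopic_paths Conf h1 (seg z1 z2 +++ h)" "homotopic_paths Conf g (seg x z1 +++ h1)" by auto
  have s: "same_stratum x z2" "homotopic_paths Conf (seg x z1 +++ seg z1 z2) (seg x z2)"
    using backtrack[OF h(1,2)] by auto
  have im: "path_image (seg p q) \<subseteq> Conf" if "step p c q" for p c q
    using seg_image_Conf step_Conf[OF that] step_below[OF that] by blast
  note hp = realizes_path[OF h(3)]
  have "homotopic_paths Conf g (seg x z1 +++ h1)" by fact
  also have "homotopic_paths Conf \<dots> (seg x z1 +++ (seg z1 z2 +++ h))"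
    using h(4) im[OF h(1)] homotopic_paths_imp_pathstart[OF h(4)] by (intro homotopic_paths_join) auto
  also have "homotopic_paths Conf \<dots> (seg x z2 +++ h)"
    using hp im[OF h(1)] im[OF h(2)] s(2) by (intro join_seg_cong) auto
  finally show ?case
    using realizes_homotopic[OF realizes_prepend_same_stratum[OF s(1) h(3)]] by simp
next
  case (Cons c u)
  then show ?case unfolding append.simps realizes.simps by blast
qed

section \<open>The monodromy of a word\<close>


text \<open>
The contribution of particle \<open>i\<close> to the transport from \<open>y\<close> to \<open>x\<close>, for \<open>x\<close> below \<open>y\<close>.
\<close>

definition move :: "nat \<Rightarrow> (nat \<Rightarrow> 'v \<Rightarrow> real) \<Rightarrow> (nat \<Rightarrow> 'v \<Rightarrow> real) \<Rightarrow>
    ('v letter list \<Rightarrow> int) \<Rightarrow> 'v letter list \<Rightarrow> int" where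
  "move i x y = (if supp (x i) = supp (y i) then id else magnus 1 (i, supp (x i), supp (y i)))"

primrec moves :: "nat \<Rightarrow> (nat \<Rightarrow> 'v \<Rightarrow> real) \<Rightarrow> (nat \<Rightarrow> 'v \<Rightarrow> real) \<Rightarrow>
    ('v letter list \<Rightarrow> int) \<Rightarrow> 'v letter list \<Rightarrow> int" where
  "moves 0 x y f = f"
| "moves (Suc n) x y f = moves n x y (move n x y f)"

abbreviation "M \<equiv> magnus_functions (independent :: 'v letter \<Rightarrow> 'v letter \<Rightarrow> bool)"

lemma move_in: "f \<in> M \<Longrightarrow> move i x y f \<in> M"
  by (simp add: move_def magnus_in)

lemma move_bij: "bij_betw (move i x y) M M"
  by (simp add: move_def magnus_bij)

lemma moves_bij: "bij_betw (moves n x y) M M"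
proof (induction n)
  case 0
  have "moves 0 x y = id" by auto
  then show ?case by (metis bij_betw_id)
next
  case (Suc n)
  have "moves (Suc n) x y = moves n x y \<circ> move n x y" by auto
  then show ?case by (metis bij_betw_trans[OF move_bij Suc])
qed

lemma moves_cong:
  assumes "\<And>i. i < n \<Longrightarrow> supp (x i) = supp (x' i)" "\<And>i. i < n \<Longrightarrow> supp (y i) = supp (y' i)"
  shows "moves n x y f = moves n x' y' f"
  using assms by (induction n arbitrary: f) (auto simp: move_def)

lemma moves_refl: "moves n x x f = f"
  by (induction n) (auto simp: move_def)

lemma moves_up:
  assumes "up x a y" "n \<le> N"
  shows "moves n x y f = (if fst a < n then magnus 1 a f else f)"
  using assms(2)
proof (induction n arbitrary: f)
  case (Suc n)
  have "move n x y f = (if n = fst a then magnus 1 a f else f)"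
    using assms(1) Suc.prems by (auto simp: move_def up_def)
  then show ?case using Suc by (auto simp: less_Suc_eq)
qed simp

text \<open>
Between \<open>x\<close>, \<open>y\<close> and \<open>z\<close> a particle can leave a vertex only once.
\<close>

lemma move_comp:
  assumes "x \<in> Conf" "y \<in> Conf" "z \<in> Conf" "below x y" "below y z" "i < N"
  shows "move i x z f = move i x y (move i y z f)"
proof -
  have "supp (x i) = supp (y i) \<or> supp (y i) = supp (z i)"
  proof (rule ccontr)
    assume "\<not> ?thesis"
    then have "supp (x i) \<subset> supp (y i)" "supp (y i) \<subset> supp (z i)" using below_supp assms by blast+
    moreover have "x i \<in> P" "y i \<in> P" "z i \<in> P" using Conf_point assms by auto
    ultimately obtain v w v' where "v \<noteq> w" "supp (y i) = {v, w}" "supp (y i) = {v'}"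
      using proper_face[of "x i" "y i"] proper_face[of "y i" "z i"] by metis
    then show False by (auto simp: doubleton_eq_iff)
  qed
  then show ?thesis by (auto simp: move_def)
qed

text \<open>
Particle \<open>j\<close> is at its vertex in \<open>x\<close> already, hence not at the vertex of particle \<open>i\<close>.
\<close>

lemma move_commute:
  assumes "x \<in> Conf" "y \<in> Conf" "z \<in> Conf" "below x y" "below y z" "i < N" "j < N" "i \<noteq> j" "f \<in> M"
  shows "move i x y (move j y z f) = move j y z (move i x y f)"
proof (cases "supp (x i) = supp (y i) \<or> supp (y j) = supp (z j)")
  case False
  then have "supp (x i) \<subset> supp (y i)" "supp (y j) \<subset> supp (z j)" using below_supp assms by blast+
  then obtain v v' where v: "supp (x i) = {v}" "supp (y j) = {v'}"
    using proper_face Conf_point assms by metis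
  have "v \<noteq> v'"
  proof
    assume "v = v'"
    then have "supp (x j) = {v}"
      using v below_supp[of x y j] supp_nonempty Conf_point assms by (metis subset_singletonD)
    then show False using Conf_vertex_neq v assms by metis
  qed
  then show ?thesis
    using False magnus_commute[of f independent] assms v by (simp add: move_def independent_def)
qed (auto simp: move_def)

lemma moves_comp:
  assumes xyz: "x \<in> Conf" "y \<in> Conf" "z \<in> Conf" "below x y" "below y z" and "n \<le> N" "f \<in> M"
  shows "moves n x z f = moves n x y (moves n y z f)"
  using assms(6,7)
proof (induction n arbitrary: f)
  case (Suc n)
  have com: "moves m y z (move n x y g) = move n x y (moves m y z g)" if "m \<le> n" "g \<in> M" for m g
    using that
  proof (induction m arbitrary: g)
    case (Suc m)
    have "moves (Suc m) y z (move n x y g) = moves m y z (move n x y (move m y z g))"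
      using move_commute[OF xyz, of n m g] Suc.prems \<open>Suc n \<le> N\<close> by simp
    also have "\<dots> = move n x y (moves (Suc m) y z g)"
      using Suc.IH[of "move m y z g"] Suc.prems move_in by simp
    finally show ?case .
  qed simp
  have "moves (Suc n) x z f = moves n x z (move n x y (move n y z f))"
    using move_comp[OF xyz, of n f] Suc.prems by simp
  also have "\<dots> = moves n x y (moves n y z (move n x y (move n y z f)))"
    using Suc move_in by simp
  also have "\<dots> = moves n x y (move n x y (moves n y z (move n y z f)))"
    using com[of n "move n y z f"] Suc.prems move_in by simp
  finally show ?case by simp
qed simp

sublocale transport: local_system Conf below "moves N" M
proof
  fix x assume "x \<in> Conf"
  then obtain U where U: "open U" "x \<in> U" "\<forall>y\<in>U. (\<forall>i<N. y i \<in> P) \<longrightarrow> y \<in> Conf \<and> below x y"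
    using below_nbhd by metis
  have "below x y" if "y \<in> U \<inter> Conf" for y
    using bspec[OF U(3), of y] that Conf_point by simp
  with U(1,2) show "\<exists>U. open U \<and> x \<in> U \<and> (\<forall>y\<in>U \<inter> Conf. below x y)" by blast
next
  fix x y z f assume "x \<in> Conf" "y \<in> Conf" "z \<in> Conf" "below x y" "below y z" "f \<in> M"
  then show "moves N x z f = moves N x y (moves N y z f)" by (intro moves_comp) simp_all
qed (simp_all only: moves_bij moves_refl)

text \<open>
All the points of the straight line after \<open>x\<close> itself lie in the stratum of \<open>y\<close>, so the flat section
is constant there and jumps only at the start.
\<close>

lemma transport_seg:
  assumes xy: "x \<in> Conf" "y \<in> Conf" "below x y" and f: "f \<in> M"
  shows "transport.transport (seg x y) (moves N x y f) f"
proof -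
  let ?F = "\<lambda>t::real. if t = 0 then moves N x y f else f"
  have m: "moves N x y f \<in> M" using moves_bij[of N x y] f by (auto simp: bij_betw_def)
  have "transport.flat (seg x y) {0..1} ?F"
  proof (rule transport.flatI)
    fix t :: real assume t: "t \<in> {0..1}"
    show "?F t \<in> M" using m f by simp
    have s: "supp (seg x y u i) = supp (y i)" if "u \<in> {0<..1}" "i < N" for u i
      using seg_supp[OF xy] that by auto
    show "\<exists>U. open U \<and> t \<in> U \<and> (\<forall>u\<in>U \<inter> {0..1}. ?F t = moves N (seg x y t) (seg x y u) (?F u))"
    proof (cases "t = 0")
      case True
      have "?F 0 = moves N (seg x y 0) (seg x y u) (?F u)" if "u \<in> {0..1}" for u
      proof (cases "u = 0")
        case False
        have "moves N x (seg x y u) f = moves N x y f"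
          by (rule moves_cong) (use s that False in auto)
        then show ?thesis using False by simp
      qed (simp add: moves_refl)
      then show ?thesis unfolding True by (intro exI[of _ UNIV]) auto
    next
      case False
      have "f = moves N (seg x y t) (seg x y u) f" if "u \<in> {0<..} \<inter> {0..1}" for u
      proof -
        have "moves N (seg x y t) (seg x y u) f = moves N y y f"
          by (rule moves_cong) (use s that False t in auto)
        then show ?thesis by (simp add: moves_refl)
      qed
      then show ?thesis using False t by (intro exI[of _ "{0<..}"]) auto
    qed
  qed
  then show ?thesis
    unfolding transport.transport_def by (intro exI[of _ ?F]) auto
qed

lemma transport_step:
  assumes "step x a y"
  shows "\<exists>\<epsilon>\<in>{1, -1}. \<forall>f\<in>M. transport.transport (seg x y) (magnus \<epsilon> a f) f"
proof -
  have up: "transport.transport (seg u v) (magnus 1 a f) f" if "up u a v" "f \<in> M" for u v f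
  proof -
    have "moves N u v f = magnus 1 a f" using moves_up[OF that(1), of N f] that(1) by (simp add: up_def)
    then show ?thesis using transport_seg[of u v f] that by (auto simp: up_def)
  qed
  from assms consider "up x a y" | "up y a x" by (auto simp: step_def)
  then show ?thesis
  proof cases
    case 1
    then show ?thesis using up by blast
  next
    case 2
    have "transport.transport (seg x y) (magnus (- 1) a f) f" if "f \<in> M" for f
      using transport.transport_reverse[OF up[OF 2 magnus_in[OF that, of "- 1" a]]]
        magnus_inverse[OF that, of 1 a] by simp
    then show ?thesis by blast
  qed
qed

lemma transport_realizes:
  assumes "realizes w x g y"
  shows "\<exists>s. map snd s = w \<and> set (map fst s) \<subseteq> {1, -1} \<and>
    (\<forall>f\<in>M. transport.transport g (magnus_word s f) f)"
  using assms
proof (induction w arbitrary: x g)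
  case Nil
  then have xy: "x \<in> Conf" "y \<in> Conf" "below x y" and g: "homotopic_paths Conf g (seg x y)" and s: "same_stratum x y"
    by (auto simp: same_stratum_def)
  have "transport.transport g f f" if "f \<in> M" for f
  proof -
    have "moves N x y f = moves N y y f"
      by (rule moves_cong) (use same_stratum_supp[OF s] in auto)
    then have "transport.transport (seg x y) f f"
      using transport_seg[OF xy that] by (simp add: moves_refl)
    then show ?thesis
      using transport.transport_homotopic g homotopic_paths_sym by blast
  qed
  then show ?case by (intro exI[of _ "[]"]) auto
next
  case (Cons a w)
  then obtain z h where z: "step x a z" "realizes w z h y" "homotopic_paths Conf g (seg x z +++ h)" by auto
  obtain s where s: "map snd s = w" "set (map fst s) \<subseteq> {1, -1}"
    "\<forall>f\<in>M. transport.transport h (magnus_word s f) f"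
    using Cons.IH[OF z(2)] by blast
  obtain \<epsilon> where \<epsilon>: "\<epsilon> \<in> {1, -1}" "\<forall>f\<in>M. transport.transport (seg x z) (magnus \<epsilon> a f) f"
    using transport_step[OF z(1)] by blast
  have "transport.transport g (magnus_word ((\<epsilon>, a) # s) f) f" if "f \<in> M" for f
  proof -
    have "transport.transport (seg x z +++ h) (magnus \<epsilon> a (magnus_word s f)) f"
      using \<epsilon>(2) s(3) that magnus_word_in[OF that] realizes_path(3)[OF z(2)]
      by (intro transport.transport_join[of _ _ "magnus_word s f"]) auto
    then show ?thesis
      using transport.transport_homotopic z(3) homotopic_paths_sym by fastforce
  qed
  then show ?case using s \<epsilon> by (intro exI[of _ "(\<epsilon>, a) # s"]) auto
qed

definition swap :: "'v letter list \<Rightarrow> 'v letter list \<Rightarrow> bool" where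
  "swap u v \<longleftrightarrow> (\<exists>p q a b. independent a b \<and> u = p @ [a, b] @ q \<and> v = p @ [b, a] @ q)"

text \<open>
A shortest word \<open>w\<close> of the loop is compared with the indicator function of the words that arise from
it by exchanges.  Minimality makes this function vanish on words with a repeated letter, and the top
coefficient shows that the transport along the loop moves it unless \<open>w\<close> is empty.
\<close>

lemma null_homotopic_if_power_null_homotopic:
  assumes g: "path g" "path_image g \<subseteq> Conf" "pathfinish g = pathstart g"
    and n: "n > 0" and null: "homotopic_paths Conf (loop_power g n) (\<lambda>_. pathstart g)"
  shows "homotopic_paths Conf g (\<lambda>_. pathstart g)"
proof -
  let ?p = "pathstart g"
  have p: "?p \<in> Conf" using g by (auto simp: path_image_def pathstart_def)
  obtain w where w: "realizes w ?p g ?p"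
    and min: "\<And>v. realizes v ?p g ?p \<Longrightarrow> length w \<le> length v"
    using realizes_exists[OF g(1,2)] g(3) ex_has_least_nat[of "\<lambda>w. realizes w ?p g ?p" _ length] by metis
  show ?thesis
  proof (cases "w = []")
    case True
    then show ?thesis using w by simp
  next
    case False
    have swap_realizes: "realizes v ?p g ?p" if "swap\<^sup>*\<^sup>* w v" for v
      using that
    proof induction
      case (step u v)
      then show ?case using realizes_shuffle unfolding swap_def by blast
    qed (rule w)
    have swap_length: "length v = length w" if "swap\<^sup>*\<^sup>* w v" for v
      using that by induction (auto simp: swap_def)
    define f where "f v = (if swap\<^sup>*\<^sup>* w v then 1 else 0 :: int)" for v
    have fM: "f \<in> M"
      unfolding magnus_functions_def
    proof (intro CollectI conjI allI impI)
      fix u v and a b :: "'v letter" assume "independent a b"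
      then have "swap (u @ [a, b] @ v) (u @ [b, a] @ v)" "swap (u @ [b, a] @ v) (u @ [a, b] @ v)"
        using independent_sym unfolding swap_def by blast+
      then have "swap\<^sup>*\<^sup>* w (u @ [a, b] @ v) \<longleftrightarrow> swap\<^sup>*\<^sup>* w (u @ [b, a] @ v)"
        by (meson rtranclp.rtrancl_into_rtrancl)
      then show "f (u @ [a, b] @ v) = f (u @ [b, a] @ v)" by (simp add: f_def)
    next
      fix u v and a :: "'v letter"
      have "\<not> swap\<^sup>*\<^sup>* w (u @ [a, a] @ v)"
      proof
        assume *: "swap\<^sup>*\<^sup>* w (u @ [a, a] @ v)"
        have "length w \<le> length (u @ v)" using min realizes_cancel swap_realizes[OF *] by blast
        with swap_length[OF *] show False by simp
      qed
      then show "f (u @ [a, a] @ v) = 0" by (simp add: f_def)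
    qed
    obtain s where s: "map snd s = w" "set (map fst s) \<subseteq> {1, -1}"
      and tr: "\<And>f. f \<in> M \<Longrightarrow> transport.transport g (magnus_word s f) f"
      using transport_realizes[OF w] by blast
    let ?T = "magnus_word s"
    have pow: "transport.transport (loop_power g k) ((?T ^^ k) h) h \<and> pathfinish (loop_power g k) = ?p"
      if "h \<in> M" for k h
      using that
    proof (induction k arbitrary: h)
      case 0
      then show ?case
        using transport.flat_const[OF p 0] unfolding transport.transport_def
        by (auto simp: pathfinish_def pathstart_def)
    next
      case (Suc k)
      have "transport.transport (loop_power g k +++ g) ((?T ^^ k) (?T h)) h"
        using Suc magnus_word_in[OF Suc.prems] tr[OF Suc.prems]
        by (intro transport.transport_join[of _ _ "?T h"]) auto
      then show ?case using g(3) by (simp add: funpow_swap1)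
    qed
    have "transport.transport (\<lambda>_. ?p) ((?T ^^ n) f) f"
      using transport.transport_homotopic[OF null] pow[OF fM] by blast
    then obtain F :: "real \<Rightarrow> 'v letter list \<Rightarrow> int" where F: "transport.flat (\<lambda>_. ?p) {0..1} F" "F 0 = (?T ^^ n) f" "F 1 = f"
      unfolding transport.transport_def by blast
    have "(?T ^^ n) f = f"
      using transport.transport_const_eq[OF p F(1), of 0 1] F by simp
    moreover have "f v = 0" if "length v \<ge> Suc (length w)" for v
      using swap_length[of v] that by (auto simp: f_def)
    ultimately have "?T f = f" using magnus_word_power_fixed[OF n] by blast
    moreover have "?T f [] = prod_list (map fst s) * f w"
    proof -
      have "f v = 0" if "length v \<noteq> length w" for v
        using swap_length[of v] that by (auto simp: f_def)
      moreover have "length s = length w" using s(1) by (metis length_map)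
      ultimately show ?thesis
        using magnus_word_top_coefficient[of "length w" f "[]" s] s(1) by simp
    qed
    moreover have "f w = 1" by (simp add: f_def)
    moreover have "f [] = 0" using False swap_length[of "[]"] by (auto simp: f_def)
    moreover have "prod_list (map fst s) \<noteq> 0"
      using s(2) by (auto simp: prod_list_zero_iff)
    ultimately show ?thesis by simp
  qed
qed

end

section \<open>Barycentric coordinates on a finite graph\<close>

definition edge_point :: "'v \<Rightarrow> 'v \<Rightarrow> real \<Rightarrow> 'v \<Rightarrow> real" where
  "edge_point a b s = (\<lambda>v. (1 - s) * of_bool (v = a) + s * of_bool (v = b))"

text \<open>
Any family of segments between unit vectors will do: a point whose support is contained in that of a
point of an edge is determined by its weights, and hence lies on the same edge.
\<close>

lemma straight_graph_edges:
  fixes E :: "('v \<times> 'v) set"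
  shows "straight_graph {edge_point a b s | a b s. (a, b) \<in> E \<and> 0 \<le> s \<and> s \<le> 1}"
proof -
  let ?P = "{edge_point a b s | a b s. (a, b) \<in> E \<and> 0 \<le> s \<and> s \<le> 1}"
  have sp: "supp (edge_point a b s) \<subseteq> {a, b}" for a b :: 'v and s
    by (auto simp: supp_def edge_point_def)
  have tot: "sum p (supp p) = 1" if p: "p = edge_point a b s" for p and a b :: 'v and s
  proof -
    have "sum p (supp p) = sum p {a, b}"
      using sp[of a b s] p by (intro sum.mono_neutral_left) (auto simp: supp_def)
    also have "\<dots> = 1" by (cases "a = b") (auto simp: p edge_point_def)
    finally show ?thesis .
  qed
  have nn: "0 \<le> edge_point a b s v" if "0 \<le> s" "s \<le> 1" for a b v :: 'v and s
    using that by (auto simp: edge_point_def)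
  show ?thesis
  proof
    fix p v assume "p \<in> ?P"
    then show "0 \<le> p v" using nn by auto
  next
    fix p assume "p \<in> ?P"
    then show "\<exists>v w. supp p \<subseteq> {v, w}" using sp by blast
  next
    fix p assume "p \<in> ?P"
    then show "sum p (supp p) = 1" using tot by blast
  next
    fix p q and t :: real
    assume p: "p \<in> ?P" and q: "q \<in> ?P" and pq: "supp p \<subseteq> supp q" and t: "0 \<le> t" "t \<le> 1"
    obtain c d r where r: "q = edge_point c d r" "(c, d) \<in> E" "0 \<le> r" "r \<le> 1" using q by auto
    have pcd: "supp p \<subseteq> {c, d}" using pq sp r by blast
    have pt: "sum p (supp p) = 1" using p tot by blast
    have pnn: "0 \<le> p v" for v using p nn by auto
    have "sum p (supp p) = sum p {c, d}"
      using pcd by (intro sum.mono_neutral_left) (auto simp: supp_def)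
    then have sum1: "sum p {c, d} = 1" using pt by simp
    have out: "p v = 0" if "v \<noteq> c" "v \<noteq> d" for v using outside_supp[OF pcd, of v] that by simp
    show "(\<lambda>v. (1 - t) * p v + t * q v) \<in> ?P"
    proof (cases "c = d")
      case True
      then have "p = q" using sum1 out r by (auto simp: edge_point_def fun_eq_iff)
      moreover have "(\<lambda>v. (1 - t) * q v + t * q v) = q" by (auto simp: algebra_simps)
      ultimately show ?thesis using q by simp
    next
      case False
      then have pc: "p c = 1 - p d" using sum1 by simp
      let ?s = "(1 - t) * p d + t * r"
      have "(\<lambda>v. (1 - t) * p v + t * q v) = edge_point c d ?s"
      proof
        fix v
        show "(1 - t) * p v + t * q v = edge_point c d ?s v"
          using False out[of v] by (auto simp: pc r(1) edge_point_def algebra_simps)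
      qed
      moreover have "0 \<le> ?s" using t r pnn by simp
      moreover have "?s \<le> 1"
        using convex_bound_le[of "p d" 1 r "1 - t" t] pc pnn[of c] r t by simp
      ultimately show ?thesis using r(2) by blast
    qed
  qed
qed

text \<open>
The point of parameter \<open>t\<close> on an edge \<open>e\<close> from \<open>a\<close> to \<open>b\<close>, in the coordinates of its subdivision by
two new vertices \<open>(e, False)\<close> at \<open>1/3\<close> and \<open>(e, True)\<close> at \<open>2/3\<close>.  The coordinate of a vertex is its
tent function.  Two new vertices per edge suffice to resolve both loops and multiple edges.
\<close>

definition thirds :: "'a \<Rightarrow> 'a \<Rightarrow> 'e \<Rightarrow> real \<Rightarrow> 'a + 'e \<times> bool \<Rightarrow> real" where
  "thirds a b e t v = (case v of
     Inl u \<Rightarrow> of_bool (u = a) * max 0 (1 - 3 * t) + of_bool (u = b) * max 0 (3 * t - 2)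
   | Inr (e', c) \<Rightarrow> of_bool (e' = e) * max 0 (1 - \<bar>3 * t - (if c then 2 else 1)\<bar>))"

lemma thirds_first:
  assumes "0 \<le> t" "t \<le> 1"
  shows "thirds a b e (t / 3) = edge_point (Inl a) (Inr (e, False)) t"
  using assms by (auto simp: thirds_def edge_point_def fun_eq_iff split: sum.splits)

lemma thirds_second:
  assumes "0 \<le> t" "t \<le> 1"
  shows "thirds a b e ((1 + t) / 3) = edge_point (Inr (e, False)) (Inr (e, True)) t"
  using assms by (auto simp: thirds_def edge_point_def fun_eq_iff add_divide_distrib split: sum.splits)

lemma thirds_third:
  assumes "0 \<le> t" "t \<le> 1"
  shows "thirds a b e ((2 + t) / 3) = edge_point (Inr (e, True)) (Inl b) t"
  using assms by (auto simp: thirds_def edge_point_def fun_eq_iff add_divide_distrib split: sum.splits)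

lemma thirds_cases:
  fixes t :: real
  assumes "0 \<le> t" "t \<le> 1"
  shows "\<exists>s\<in>{0..1}. t = s / 3 \<or> t = (1 + s) / 3 \<or> t = (2 + s) / 3"
proof -
  consider "3 * t \<le> 1" | "1 \<le> 3 * t" "3 * t \<le> 2" | "2 \<le> 3 * t" by linarith
  then show ?thesis
  proof cases
    case 1 then show ?thesis using assms by (intro bexI[of _ "3 * t"]) auto
  next
    case 2 then show ?thesis using assms by (intro bexI[of _ "3 * t - 1"]) auto
  next
    case 3 then show ?thesis using assms by (intro bexI[of _ "3 * t - 2"]) auto
  qed
qed

lemma continuous_thirds: "continuous_on S (\<lambda>t. thirds a b e t v)"
  unfolding thirds_def by (cases v) (auto intro!: continuous_intros)

lemma thirds_inj:
  assumes "0 < t" "t < 1" "0 < t'" "t' < 1" "thirds a b e t = thirds a' b' e' t'"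
  shows "e = e' \<and> t = t'"
proof -
  have F: "thirds a b e t (Inr (e, False)) = thirds a' b' e' t' (Inr (e, False))"
    and T: "thirds a b e t (Inr (e, True)) = thirds a' b' e' t' (Inr (e, True))"
    using assms(5) by simp_all
  have "e = e'"
  proof (rule ccontr)
    assume "e \<noteq> e'"
    then show False using F T assms(1-4) by (auto simp: thirds_def max_def split: if_splits)
  qed
  then show ?thesis
    using F T assms(1-4) by (auto simp: thirds_def max_def abs_if split: if_splits)
qed

text \<open>
The barycentric coordinates of the subdivided graph are continuous because the preimage of a closed
set is the union of finitely many vertices and, for each of the finitely many edges, the image of a
compact subset of the unit interval.  A continuous bijection from a compact space to a Hausdorff space is a homeomorphism.
\<close>

lemma finite_graph_straightening:
  fixes \<Gamma> :: "'a topology"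
  assumes "finite_graph \<Gamma>"
  shows "\<exists>P \<kappa> \<kappa>'. straight_graph (P :: ('a + 'a set \<times> bool \<Rightarrow> real) set) \<and>
    homeomorphic_maps \<Gamma> (top_of_set P) \<kappa> \<kappa>'"
proof -
  obtain V \<E> where H: "Hausdorff_space \<Gamma>" and V: "finite V" and E: "finite \<E>" "pairwise disjnt \<E>"
    and VE: "disjnt V (\<Union>\<E>)" and top: "topspace \<Gamma> = V \<union> \<Union>\<E>"
    and ex: "\<forall>e\<in>\<E>. \<exists>\<phi>. continuous_map (top_of_set {0..1::real}) \<Gamma> \<phi> \<and> \<phi> 0 \<in> V \<and> \<phi> 1 \<in> V \<and>
           homeomorphic_map (top_of_set {0<..<1}) (subtopology \<Gamma> e) \<phi>"
    using assms unfolding finite_graph_def by blast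
  obtain \<phi> where \<phi>: "\<And>e. e \<in> \<E> \<Longrightarrow> continuous_map (top_of_set {0..1::real}) \<Gamma> (\<phi> e)"
    "\<And>e. e \<in> \<E> \<Longrightarrow> \<phi> e 0 \<in> V" "\<And>e. e \<in> \<E> \<Longrightarrow> \<phi> e 1 \<in> V"
    "\<And>e. e \<in> \<E> \<Longrightarrow> homeomorphic_map (top_of_set {0<..<1}) (subtopology \<Gamma> e) (\<phi> e)"
    using bchoice[OF ex] by blast
  have im: "\<phi> e ` {0<..<1} = e" and inj: "inj_on (\<phi> e) {0<..<1}" if "e \<in> \<E>" for e
    using homeomorphic_imp_surjective_map[OF \<phi>(4)[OF that]]
      homeomorphic_imp_injective_map[OF \<phi>(4)[OF that]] top that by auto
  define b where "b e = thirds (\<phi> e 0) (\<phi> e 1) e" for e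
  define \<kappa> :: "'a \<Rightarrow> 'a + 'a set \<times> bool \<Rightarrow> real" where
    "\<kappa> x = (if x \<in> V then edge_point (Inl x) (Inl x) 0
      else let e = (THE e. e \<in> \<E> \<and> x \<in> e) in b e (inv_into {0<..<1} (\<phi> e) x))" for x
  have \<kappa>V: "\<kappa> x = edge_point (Inl x) (Inl x) 0" if "x \<in> V" for x using that by (simp add: \<kappa>_def)
  have \<kappa>E: "\<kappa> (\<phi> e t) = b e t" if e: "e \<in> \<E>" and t: "0 \<le> t" "t \<le> 1" for e t
  proof -
    consider "t = 0" | "t = 1" | "t \<in> {0<..<1}" using t by fastforce
    then show ?thesis
    proof cases
      case 1
      then show ?thesis using \<kappa>V[OF \<phi>(2)[OF e]]
        by (auto simp: b_def thirds_def edge_point_def fun_eq_iff split: sum.splits)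
    next
      case 2
      then show ?thesis using \<kappa>V[OF \<phi>(3)[OF e]]
        by (auto simp: b_def thirds_def edge_point_def fun_eq_iff split: sum.splits)
    next
      case 3
      then have x: "\<phi> e t \<in> e" using im[OF e] by blast
      then have "\<phi> e t \<notin> V" using VE e by (auto simp: disjnt_iff)
      moreover have "(THE e'. e' \<in> \<E> \<and> \<phi> e t \<in> e') = e"
        using x e E(2) by (intro the_equality) (auto simp: pairwise_def disjnt_iff)
      ultimately show ?thesis using 3 inj[OF e] by (simp add: \<kappa>_def)
    qed
  qed
  have pts: "(\<exists>e\<in>\<E>. \<exists>t. 0 < t \<and> t < 1 \<and> x = \<phi> e t)" if x: "x \<in> topspace \<Gamma>" "x \<notin> V" for x
  proof -
    obtain e where "e \<in> \<E>" "x \<in> e" using x top by auto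
    moreover from this obtain t where "t \<in> {0<..<1}" "x = \<phi> e t" using im by blast
    ultimately show ?thesis by auto
  qed
  have \<phi>top: "\<phi> e t \<in> topspace \<Gamma>" if "e \<in> \<E>" "0 \<le> t" "t \<le> 1" for e t
    using \<phi>(1)[OF that(1)] that by (auto simp: continuous_map_def)
  define Q where "Q = (\<lambda>x. (Inl x, Inl x)) ` V \<union>
    (\<Union>e\<in>\<E>. {(Inl (\<phi> e 0), Inr (e, False)), (Inr (e, False), Inr (e, True)), (Inr (e, True), Inl (\<phi> e 1))})"
  define P where "P = {edge_point a b s | a b s. (a, b) \<in> Q \<and> 0 \<le> s \<and> s \<le> 1}"
  have \<kappa>P: "\<kappa> ` topspace \<Gamma> = P"
  proof (intro subset_antisym subsetI)
    fix p assume "p \<in> \<kappa> ` topspace \<Gamma>"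
    then obtain x where x: "x \<in> topspace \<Gamma>" "p = \<kappa> x" by blast
    show "p \<in> P"
    proof (cases "x \<in> V")
      case True
      then show ?thesis using x \<kappa>V unfolding P_def Q_def by fastforce
    next
      case False
      then obtain e t where e: "e \<in> \<E>" "0 < t" "t < 1" "x = \<phi> e t" using pts x by blast
      then have p: "p = thirds (\<phi> e 0) (\<phi> e 1) e t" using \<kappa>E x by (simp add: b_def)
      obtain s where s: "0 \<le> s" "s \<le> 1" "t = s / 3 \<or> t = (1 + s) / 3 \<or> t = (2 + s) / 3"
      proof -
        have "\<exists>s\<in>{0..1}. t = s / 3 \<or> t = (1 + s) / 3 \<or> t = (2 + s) / 3"
          by (rule thirds_cases) (use e in simp_all)
        then show thesis by (elim bexE) (rule that; simp)
      qed
      have "p = edge_point (Inl (\<phi> e 0)) (Inr (e, False)) s \<or>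
        p = edge_point (Inr (e, False)) (Inr (e, True)) s \<or>
        p = edge_point (Inr (e, True)) (Inl (\<phi> e 1)) s"
        using s p thirds_first[OF s(1,2)] thirds_second[OF s(1,2)] thirds_third[OF s(1,2)] by metis
      moreover have "(Inl (\<phi> e 0), Inr (e, False)) \<in> Q" "(Inr (e, False), Inr (e, True)) \<in> Q"
        "(Inr (e, True), Inl (\<phi> e 1)) \<in> Q"
        using e(1) by (auto simp: Q_def)
      ultimately show ?thesis using s(1,2) unfolding P_def by blast
    qed
  next
    fix p assume "p \<in> P"
    then obtain a a' s where p: "p = edge_point a a' s" "(a, a') \<in> Q" "0 \<le> s" "s \<le> 1"
      by (auto simp: P_def)
    have edge: "p \<in> \<kappa> ` topspace \<Gamma>" if "e \<in> \<E>" "0 \<le> t" "t \<le> 1" "p = b e t" for e t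
      by (rule image_eqI[of _ _ "\<phi> e t"]) (use that(4) \<kappa>E[OF that(1-3)] \<phi>top[OF that(1-3)] in simp_all)
    have "(\<exists>x\<in>V. a = Inl x \<and> a' = Inl x) \<or>
      (\<exists>e\<in>\<E>. a = Inl (\<phi> e 0) \<and> a' = Inr (e, False)) \<or>
      (\<exists>e\<in>\<E>. a = Inr (e, False) \<and> a' = Inr (e, True)) \<or>
      (\<exists>e\<in>\<E>. a = Inr (e, True) \<and> a' = Inl (\<phi> e 1))"
      using p(2) by (auto simp: Q_def)
    then consider x where "x \<in> V" "a = Inl x" "a' = Inl x"
      | e where "e \<in> \<E>" "a = Inl (\<phi> e 0)" "a' = Inr (e, False)"
      | e where "e \<in> \<E>" "a = Inr (e, False)" "a' = Inr (e, True)"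
      | e where "e \<in> \<E>" "a = Inr (e, True)" "a' = Inl (\<phi> e 1)"
      by blast
    then show "p \<in> \<kappa> ` topspace \<Gamma>"
    proof cases
      case 1
      then have "p = \<kappa> x" using p(1) \<kappa>V by (auto simp: edge_point_def)
      then show ?thesis using 1 top by auto
    next
      case 2
      show ?thesis
        by (rule edge[of e "s / 3"]) (use 2 p thirds_first[OF p(3,4), of "\<phi> e 0" "\<phi> e 1" e] in \<open>simp_all add: b_def\<close>)
    next
      case 3
      show ?thesis
        by (rule edge[of e "(1 + s) / 3"]) (use 3 p thirds_second[OF p(3,4), of "\<phi> e 0" "\<phi> e 1" e] in \<open>simp_all add: b_def\<close>)
    next
      case 4
      show ?thesis
        by (rule edge[of e "(2 + s) / 3"]) (use 4 p thirds_third[OF p(3,4), of "\<phi> e 0" "\<phi> e 1" e] in \<open>simp_all add: b_def\<close>)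
    qed
  qed
  have "inj_on \<kappa> (topspace \<Gamma>)"
  proof (rule inj_onI)
    have pos: "\<exists>c. \<kappa> x (Inr c) \<noteq> 0" if x: "x \<in> topspace \<Gamma>" "x \<notin> V" for x
    proof -
      obtain e t where e: "e \<in> \<E>" "0 < t" "t < 1" "x = \<phi> e t" using pts[OF x] by blast
      then have "\<kappa> x (Inr (e, t > 1/2)) \<noteq> 0" using \<kappa>E by (auto simp: b_def thirds_def max_def abs_if)
      then show ?thesis by blast
    qed
    have zero: "\<kappa> x (Inr c) = 0" if "x \<in> V" for x c using \<kappa>V[OF that] by (simp add: edge_point_def)
    fix x y assume xy: "x \<in> topspace \<Gamma>" "y \<in> topspace \<Gamma>" "\<kappa> x = \<kappa> y"
    show "x = y"
    proof (cases "x \<in> V")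
      case True
      then have "y \<in> V" using pos[OF xy(2)] zero[OF True] xy(3) by auto
      have "\<kappa> x (Inl x) = 1" using \<kappa>V[OF True] by (simp add: edge_point_def)
      moreover have "\<kappa> y (Inl x) = of_bool (x = y)" using \<kappa>V[OF \<open>y \<in> V\<close>] by (simp add: edge_point_def)
      ultimately show ?thesis using xy(3) by (cases "x = y") simp_all
    next
      case False
      then have "y \<notin> V" using pos[OF xy(1)] zero[of y] xy(3) by auto
      then obtain e t e' t' where e: "e \<in> \<E>" "0 < t" "t < 1" "x = \<phi> e t"
        and e': "e' \<in> \<E>" "0 < t'" "t' < 1" "y = \<phi> e' t'"
        using pts[OF xy(1) False] pts[OF xy(2) \<open>y \<notin> V\<close>] by blast
      have "thirds (\<phi> e 0) (\<phi> e 1) e t = thirds (\<phi> e' 0) (\<phi> e' 1) e' t'"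
        using \<kappa>E[of e t] \<kappa>E[of e' t'] e e' xy(3) by (simp add: b_def)
      from thirds_inj[OF e(2,3) e'(2,3) this] show ?thesis using e(4) e'(4) by simp
    qed
  qed
  moreover have "continuous_map \<Gamma> (top_of_set P) \<kappa>"
  proof -
    have "continuous_map \<Gamma> euclideanreal (\<lambda>x. \<kappa> x v)" for v
      unfolding continuous_map_closedin
    proof (intro conjI allI impI)
      fix C :: "real set" assume C: "closedin euclidean C"
      let ?K = "\<lambda>e. {t \<in> {0..1}. b e t v \<in> C}"
      have "compactin (top_of_set {0..1}) (?K e)" for e
      proof -
        have "closed ({0..1} \<inter> (\<lambda>t. b e t v) -` C)"
          using C continuous_thirds unfolding b_def
          by (intro continuous_closed_preimage) auto
        then have "compact ({0..1} \<inter> ({0..1} \<inter> (\<lambda>t. b e t v) -` C))"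
          by (intro compact_Int_closed) auto
        moreover have "{0..1} \<inter> ({0..1} \<inter> (\<lambda>t. b e t v) -` C) = ?K e" by auto
        ultimately have "compact (?K e)" by simp
        moreover have "?K e \<subseteq> {0..1}" by auto
        ultimately show ?thesis by (simp only: compactin_subtopology compactin_euclidean_iff)
      qed
      then have "compactin \<Gamma> (\<phi> e ` ?K e)" if "e \<in> \<E>" for e
        using image_compactin \<phi>(1)[OF that] by blast
      then have cl: "closedin \<Gamma> (\<phi> e ` ?K e)" if "e \<in> \<E>" for e
        using compactin_imp_closedin[OF H] that by blast
      have "{x \<in> topspace \<Gamma>. \<kappa> x v \<in> C} = {x \<in> V. \<kappa> x v \<in> C} \<union> (\<Union>e\<in>\<E>. \<phi> e ` ?K e)"
      proof (intro subset_antisym subsetI)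
        fix x assume x: "x \<in> {x \<in> topspace \<Gamma>. \<kappa> x v \<in> C}"
        show "x \<in> {x \<in> V. \<kappa> x v \<in> C} \<union> (\<Union>e\<in>\<E>. \<phi> e ` ?K e)"
        proof (cases "x \<in> V")
          case False
          then obtain e t where e: "e \<in> \<E>" "0 < t" "t < 1" "x = \<phi> e t" using pts x by blast
          then have "t \<in> ?K e" using x \<kappa>E[of e t] by auto
          then show ?thesis using e(1,4) by blast
        qed (use x in auto)
      qed (use top \<phi>top \<kappa>E in auto)
      moreover have "closedin \<Gamma> {x \<in> V. \<kappa> x v \<in> C}"
        using V top by (intro closedin_Hausdorff_finite[OF H]) auto
      moreover have "closedin \<Gamma> (\<Union>e\<in>\<E>. \<phi> e ` ?K e)"
        using E(1) cl by (intro closedin_Union) auto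
      ultimately show "closedin \<Gamma> {x \<in> topspace \<Gamma>. \<kappa> x v \<in> C}" by auto
    qed auto
    then have "continuous_map \<Gamma> euclidean \<kappa>"
      using continuous_map_coordinatewise_then_product[of UNIV \<Gamma> "\<lambda>_. euclideanreal" \<kappa>]
      by (simp add: euclidean_product_topology)
    then show ?thesis using \<kappa>P by (auto simp: continuous_map_in_subtopology)
  qed
  moreover have "compact_space \<Gamma>"
  proof -
    have "compactin \<Gamma> (\<phi> e ` {0..1})" if "e \<in> \<E>" for e
      using image_compactin[OF _ \<phi>(1)[OF that]] by (simp add: compactin_subtopology)
    then have "compactin \<Gamma> (\<Union>e\<in>\<E>. \<phi> e ` {0..1})"
      using E(1) by (intro compactin_Union) auto
    moreover have "compactin \<Gamma> V"
      using V top by (intro finite_imp_compactin) auto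
    ultimately have "compactin \<Gamma> (V \<union> (\<Union>e\<in>\<E>. \<phi> e ` {0..1}))"
      by (intro compactin_Un)
    moreover have "V \<union> (\<Union>e\<in>\<E>. \<phi> e ` {0..1}) = topspace \<Gamma>"
    proof (intro subset_antisym subsetI)
      fix x assume "x \<in> topspace \<Gamma>"
      then show "x \<in> V \<union> (\<Union>e\<in>\<E>. \<phi> e ` {0..1})" using pts[of x] by fastforce
    next
      fix x assume x: "x \<in> V \<union> (\<Union>e\<in>\<E>. \<phi> e ` {0..1})"
      show "x \<in> topspace \<Gamma>"
      proof (cases "x \<in> V")
        case False
        then obtain e t where "e \<in> \<E>" "t \<in> {0..1}" "x = \<phi> e t" using x by blast
        then show ?thesis using \<phi>top[of e t] by simp
      qed (simp add: top)
    qed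
    ultimately show ?thesis by (simp add: compact_space_def)
  qed
  moreover have "Hausdorff_space (top_of_set P)"
    by (intro Hausdorff_space_subtopology, subst euclidean_product_topology[symmetric])
      (simp add: Hausdorff_space_product_topology)
  ultimately have "homeomorphic_map \<Gamma> (top_of_set P) \<kappa>"
    using \<kappa>P by (intro continuous_imp_homeomorphic_map) auto
  then obtain \<kappa>' where "homeomorphic_maps \<Gamma> (top_of_set P) \<kappa> \<kappa>'"
    using homeomorphic_map_maps by blast
  moreover have "straight_graph P" unfolding P_def by (rule straight_graph_edges)
  ultimately show ?thesis by blast
qed

section \<open>Torsion-freeness\<close>

text \<open>
The power of a loop, bracketed as in \<^const>\<open>pow\<close>.
\<close>

primrec concat_power :: "(real \<Rightarrow> 'a) \<Rightarrow> nat \<Rightarrow> real \<Rightarrow> 'a" where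
  "concat_power f 0 = (\<lambda>_. f 0)"
| "concat_power f (Suc n) = concat_loops (concat_power f n) f"

lemma concat_power_loop:
  assumes "f \<in> loops_at Y p"
  shows "concat_power f n \<in> loops_at Y p"
proof (induction n)
  case 0
  have "p \<in> topspace Y" using assms by (auto simp: loops_at_def pathin_def continuous_map_def)
  then show ?case using assms by (auto simp: loops_at_def pathin_def)
qed (use assms in \<open>auto intro: concat_loops_in_loops_at\<close>)

lemma concat_power_in_pow:
  assumes f: "f \<in> loops_at Y p" "f \<in> A"
  shows "concat_power f n \<in> A [^]\<^bsub>fundamental_group Y p\<^esub> n"
proof (induction n)
  case 0
  have "(\<lambda>_. p, \<lambda>_. p) \<in> loop_homotopy Y p"
    using equiv_loop_homotopy[of Y p] concat_power_loop[OF f(1), of 0] f(1)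
    by (auto simp: equiv_def refl_on_def loops_at_def)
  then show ?case using f(1) by (auto simp: nat_pow_def fundamental_group_def loops_at_def)
next
  case (Suc n)
  have "(concat_power f (Suc n), concat_power f (Suc n)) \<in> loop_homotopy Y p"
    using equiv_loop_homotopy[of Y p] concat_power_loop[OF f(1), of "Suc n"]
    by (auto simp: equiv_def refl_on_def)
  then show ?case
    using Suc f(2) by (force simp: nat_pow_def fundamental_group_def)
qed

text \<open>
Multiplication in the fundamental group is a union over all representatives, so it contains the
concatenation of any two of them.  Hence the power of one representative lies in the power of its
class.
\<close>

lemma torsion_free_fundamental_group_criterion:
  assumes "\<And>f n. \<lbrakk>f \<in> loops_at Y p; 0 < n; (\<lambda>_. p, concat_power f n) \<in> loop_homotopy Y p\<rbrakk>
    \<Longrightarrow> (\<lambda>_. p, f) \<in> loop_homotopy Y p"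
  shows "torsion_free (fundamental_group Y p)"
  unfolding torsion_free_def
proof (intro ballI allI impI)
  fix A and n :: nat
  assume A: "A \<in> carrier (fundamental_group Y p)" and n: "0 < n"
    and pow: "A [^]\<^bsub>fundamental_group Y p\<^esub> n = \<one>\<^bsub>fundamental_group Y p\<^esub>"
  obtain f where f: "f \<in> loops_at Y p" "A = loop_homotopy Y p `` {f}"
    using A by (auto simp: fundamental_group_def elim: quotientE)
  have "f \<in> A" using f equiv_class_self[OF equiv_loop_homotopy] by metis
  then have "concat_power f n \<in> \<one>\<^bsub>fundamental_group Y p\<^esub>"
    using concat_power_in_pow[OF f(1), of A n] pow by simp
  then have "(\<lambda>_. p, f) \<in> loop_homotopy Y p"
    using assms f(1) n by (auto simp: fundamental_group_def)
  then show "A = \<one>\<^bsub>fundamental_group Y p\<^esub>"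
    using equiv_class_eq[OF equiv_loop_homotopy] f(2) by (fastforce simp: fundamental_group_def)
qed

text \<open>
The coordinates of the particles identify the configuration space with a retract of the space of
configurations on the straightened graph: \<open>F\<close> and \<open>G\<close> translate loops and homotopies back and forth,
and \<open>G\<close> after \<open>F\<close> is the identity.
\<close>

theorem corollary3p2:
  fixes \<Gamma> :: "'a topology" and N :: nat and p :: "nat \<Rightarrow> 'a"
  assumes "finite_graph \<Gamma>"
    and "connected_space \<Gamma>"
    and "N \<ge> 1"
    and "p \<in> topspace (config_space N \<Gamma>)"
  shows "torsion_free (fundamental_group (config_space N \<Gamma>) p)"
proof (rule torsion_free_fundamental_group_criterion)
  let ?C = "config_space N \<Gamma>"
  obtain P :: "('a + 'a set \<times> bool \<Rightarrow> real) set" and \<kappa> \<kappa>' where "straight_graph P"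
    and \<kappa>: "homeomorphic_maps \<Gamma> (top_of_set P) \<kappa> \<kappa>'"
    using finite_graph_straightening[OF assms(1)] by blast
  interpret straight_graph P N by fact
  have \<kappa>c: "continuous_map \<Gamma> (top_of_set P) \<kappa>" "continuous_map (top_of_set P) \<Gamma> \<kappa>'"
    and \<kappa>i: "\<And>x. x \<in> topspace \<Gamma> \<Longrightarrow> \<kappa>' (\<kappa> x) = x" "\<And>q. q \<in> P \<Longrightarrow> \<kappa> (\<kappa>' q) = q"
    using \<kappa> by (auto simp: homeomorphic_maps_def)
  have topC: "topspace ?C = (\<Pi>\<^sub>E i\<in>{..<N}. topspace \<Gamma>) \<inter> {x. inj_on x {..<N}}"
    by (simp add: config_space_def)
  define F :: "(nat \<Rightarrow> 'a) \<Rightarrow> nat \<Rightarrow> 'a + 'a set \<times> bool \<Rightarrow> real" where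
    "F x = (\<lambda>i. if i < N then \<kappa> (x i) else (\<lambda>_. 0))" for x
  define G where "G y = restrict (\<lambda>i. \<kappa>' (y i)) {..<N}" for y :: "nat \<Rightarrow> 'a + 'a set \<times> bool \<Rightarrow> real"
  have GF: "G (F x) = x" if "x \<in> topspace ?C" for x
    using that \<kappa>i(1) by (auto simp: topC G_def F_def PiE_def extensional_def fun_eq_iff)
  have F: "continuous_map ?C (top_of_set Conf) F"
  proof -
    have "continuous_map ?C euclideanreal (\<lambda>x. F x i v)" for i v
    proof (cases "i < N")
      case True
      have "continuous_map ?C \<Gamma> (\<lambda>x. x i)"
        unfolding config_space_def using True
        by (intro continuous_map_from_subtopology continuous_map_product_projection) auto
      then have "continuous_map ?C euclidean (\<kappa> \<circ> (\<lambda>x. x i))"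
        using continuous_map_compose \<kappa>c(1) continuous_map_into_fulltopology by blast
      then have "continuous_map ?C (product_topology (\<lambda>_. euclideanreal) UNIV) (\<kappa> \<circ> (\<lambda>x. x i))"
        by (simp add: euclidean_product_topology)
      then show ?thesis
        using continuous_map_product_then_coordinatewise(1)[of ?C "\<lambda>_. euclideanreal" UNIV "\<kappa> \<circ> (\<lambda>x. x i)" v] True
        by (simp add: F_def)
    qed (simp add: F_def)
    then have "continuous_map ?C euclidean (\<lambda>x. F x i)" for i
      using continuous_map_coordinatewise_then_product[of UNIV ?C "\<lambda>_. euclideanreal" "\<lambda>x. F x i"]
      by (simp add: euclidean_product_topology)
    then have "continuous_map ?C euclidean F"
      using continuous_map_coordinatewise_then_product[of UNIV ?C "\<lambda>_. euclidean" F]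
      by (simp add: euclidean_product_topology)
    moreover have "F x \<in> Conf" if "x \<in> topspace ?C" for x
    proof (rule ConfI)
      fix i assume i: "i < N"
      then have "x i \<in> topspace \<Gamma>" using that by (auto simp: topC)
      then show "F x i \<in> P" using \<kappa>c(1) i by (auto simp: F_def continuous_map_def)
    next
      fix i j assume ij: "i < N" "j < N" "i \<noteq> j"
      then have "x i \<noteq> x j" "x i \<in> topspace \<Gamma>" "x j \<in> topspace \<Gamma>"
        using that by (auto simp: topC inj_on_def)
      then show "F x i \<noteq> F x j" using \<kappa>i(1) ij by (metis F_def)
    qed
    ultimately show ?thesis by (auto simp: continuous_map_in_subtopology)
  qed
  have G: "continuous_map (top_of_set Conf) ?C G"
  proof -
    have "continuous_map (top_of_set Conf) \<Gamma> (\<lambda>y. G y i)" if "i < N" for i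
    proof -
      have "continuous_map (top_of_set Conf) (top_of_set P) (\<lambda>y. y i)"
        using Conf_point that by (auto simp: continuous_map_in_subtopology intro: continuous_on_product_coordinates[THEN continuous_on_subset])
      then have "continuous_map (top_of_set Conf) \<Gamma> (\<kappa>' \<circ> (\<lambda>y. y i))"
        using continuous_map_compose \<kappa>c(2) by blast
      then show ?thesis using that by (simp add: G_def o_def)
    qed
    then have "continuous_map (top_of_set Conf) (product_topology (\<lambda>_. \<Gamma>) {..<N}) G"
      by (intro continuous_map_coordinatewise_then_product) (auto simp: G_def)
    moreover have "inj_on (G y) {..<N}" if "y \<in> Conf" for y
    proof (rule inj_onI)
      fix i j assume ij: "i \<in> {..<N}" "j \<in> {..<N}" "G y i = G y j"
      then have "\<kappa>' (y i) = \<kappa>' (y j)" by (simp add: G_def)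
      moreover have "y i \<in> P" "y j \<in> P" using Conf_point[OF that] ij by auto
      ultimately have "y i = y j" using \<kappa>i(2) by metis
      then show "i = j" using Conf_neq[OF that, of i j] ij by auto
    qed
    ultimately show ?thesis by (auto simp: config_space_def continuous_map_in_subtopology)
  qed
  have cont: "continuous_on {0..1} (F \<circ> g)" "F \<circ> g \<in> {0..1} \<rightarrow> Conf" if "g \<in> loops_at ?C p" for g
    using that continuous_map_compose[OF _ F, of "top_of_set {0..1}" g]
    by (auto simp: loops_at_def pathin_def)
  fix f and n :: nat
  assume f: "f \<in> loops_at ?C p" and n: "0 < n"
    and null: "(\<lambda>_. p, concat_power f n) \<in> loop_homotopy ?C p"
  have pow: "F \<circ> concat_power f k = loop_power (F \<circ> f) k" for k
    by (induction k) (auto simp: concat_loops_def joinpaths_def fun_eq_iff)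
  have f01: "f 0 = p" "f 1 = p" using f by (auto simp: loops_at_def)
  have "homotopic_with (\<lambda>h. h 0 = p \<and> h 1 = p) (top_of_set {0..1}) ?C (\<lambda>_. p) (concat_power f n)"
    using null by (simp add: loop_homotopy_def)
  then have "homotopic_with_canon (\<lambda>h. h 0 = F p \<and> h 1 = F p) {0..1} Conf (F \<circ> (\<lambda>_. p)) (loop_power (F \<circ> f) n)"
    unfolding pow[symmetric] by (rule homotopic_with_compose_continuous_map_left[OF _ F]) auto
  then have "homotopic_paths Conf (\<lambda>_. F p) (loop_power (F \<circ> f) n)"
    by (simp add: homotopic_paths_def o_def pathstart_def pathfinish_def)
  then have "homotopic_paths Conf (F \<circ> f) (\<lambda>_. pathstart (F \<circ> f))"
    using cont[OF f] n f01
    by (intro null_homotopic_if_power_null_homotopic[of _ n])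
      (auto simp: path_def path_image_def pathstart_def pathfinish_def homotopic_paths_sym_eq)
  then have "homotopic_with_canon (\<lambda>h. h 0 = F p \<and> h 1 = F p) {0..1} Conf (F \<circ> f) (\<lambda>_. F p)"
    using f01 by (simp add: homotopic_paths_def pathstart_def pathfinish_def)
  then have h: "homotopic_with (\<lambda>h. h 0 = p \<and> h 1 = p) (top_of_set {0..1}) ?C (G \<circ> (F \<circ> f)) (G \<circ> (\<lambda>_. F p))"
    by (rule homotopic_with_compose_continuous_map_left[OF _ G]) (use GF[OF assms(4)] in auto)
  have "homotopic_with (\<lambda>h. h 0 = p \<and> h 1 = p) (top_of_set {0..1}) ?C f (\<lambda>_. p)"
  proof (rule homotopic_with_eq[OF h])
    fix t assume "t \<in> topspace (top_of_set {0..1::real})"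
    then have "f t \<in> topspace ?C" using f by (auto simp: loops_at_def pathin_def continuous_map_def)
    then show "f t = (G \<circ> (F \<circ> f)) t" using GF by simp
  qed (use GF[OF assms(4)] in auto)
  then show "(\<lambda>_. p, f) \<in> loop_homotopy ?C p"
    using f assms(4) by (auto simp: loop_homotopy_def loops_at_def pathin_def homotopic_with_sym)
qed

end
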